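(* Let $t\mapsto \psi_A(t)=\sum_{i,j=1}^r X_i(t,x)S_{ij}(t)W_j(t,\xi)\in\mathcal M_r$ be a smooth curve with smoothly varying factors, where for every $t$ one has $\langle X_i,X_j\rangle_x=\delta_{ij}$, $\langle W_i,W_j\rangle_\xi=\delta_{ij}$ and $S(t)=(S_{ij}(t))\in\mathbb C^{r\times r}$ is nonsingular, so that $$\dot\psi_A=\sum_{i,j=1}^r\left(\dot X_iS_{ij}W_j+X_i\dot S_{ij}W_j+X_iS_{ij}\dot W_j\right).$$ Assume the orthogonal gauge $\langle\dot X_i,X_j\rangle_x=0$ and $\langle\dot W_i,W_j\rangle_\xi=0$ for all $i,j=1,\dots,r$. Then the Galerkin condition $$\langle\partial_t\psi_A-F(\psi_A),\eta\rangle_{x,\xi}=0\qquad\text{for all }\eta\in\mathcal T_{\psi_A}\mathcal M_r$$ is equivalent to the following system of evolution equations for the factors, for all $i,j=1,\dots,r$: $$\dot S_{ij}=\langle F(\psi_A),X_iW_j\rangle_{x,\xi},$$ $$\sum_{k=1}^rS_{ik}\dot W_k=\langle F(\psi_A),X_i\rangle_x-\sum_{k=1}^r\dot S_{ik}W_k,$$ $$\sum_{k=1}^r\dot X_kS_{kj}=\langle F(\psi_A),W_j\rangle_\xi-\sum_{k=1}^rX_k\dot S_{kj}.$$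
   Context: Let $x\in\mathbb R^m$ be the spatial variable, $\xi\in\mathbb R^n$ a random variable with probability density $\pi(\xi)$, $\varepsilon>0$ the semiclassical parameter, $V(x,\xi)$ a real potential, and $r\ge1$ a fixed integer. Functions are complex valued. Define $$\langle\psi,\phi\rangle_{x,\xi}=\int_{\mathbb R^m}\int_{\mathbb R^n}\psi\,\bar\phi\,\pi(\xi)\,\mathrm dx\,\mathrm d\xi,\quad \langle\psi,\phi\rangle_x=\int_{\mathbb R^m}\psi\,\bar\phi\,\mathrm dx,\quad \langle\psi,\phi\rangle_\xi=\int_{\mathbb R^n}\psi\,\bar\phi\,\pi(\xi)\,\mathrm d\xi,$$ where the bar is complex conjugation. Thus $\langle\cdot,\cdot\rangle_x$ of a function of $(x,\xi)$ with a function of $x$ is a function of $\xi$, and $\langle\cdot,\cdot\rangle_\xi$ of a function of $(x,\xi)$ with a function of $\xi$ is a function of $x$. The low-rank manifold is $$\mathcal M_r=\Big\{\sum_{i,j=1}^rX_i(x)S_{ij}W_j(\xi):\ \langle X_i,X_j\rangle_x=\delta_{ij},\ \langle W_i,W_j\rangle_\xi=\delta_{ij},\ S=(S_{ij})\in\mathbb C^{r\times r}\text{ nonsingular}\Big\}.$$ The tangent space $\mathcal T_{\psi_A}\mathcal M_r$ at $\psi_A\in\mathcal M_r$ is the set of derivatives at $\tau=0$ of smooth curves $\tau\mapsto\sum_{i,j}X_i(\tau)S_{ij}(\tau)W_j(\tau)$ in $\mathcal M_r$ (with smooth factors) passing through $\psi_A$ at $\tau=0$. The semiclassical Schrödinger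 equation with uncertainties is $\partial_t\psi=F(\psi)$ with $$F(\psi)=\frac1{\mathrm i\varepsilon}\left(-\frac{\varepsilon^2}{2}\Delta_x\psi+V(x,\xi)\psi\right).$$ A dot denotes the derivative in $t$. Functions are taken regular enough that all expressions are well defined, in particular $X_i\in L^2(\mathbb R^m)$, $W_j\in L^2(\mathbb R^n,\pi\,\mathrm d\xi)$ and $F(\psi_A)$ is square integrable with respect to $\pi(\xi)\,\mathrm dx\,\mathrm d\xi$. *)

theory Defs
  imports "HOL-Analysis.Analysis"
begin

section \<open>Square-integrable functions\<close>

text \<open>Elements of \<open>L\<^sup>2\<close> are represented by honest functions, so two functions that agree almost
  everywhere stand for the same element.\<close>

definition L2 :: "'z measure \<Rightarrow> ('z \<Rightarrow> complex) set" where
  "L2 M = {f \<in> borel_measurable M. integrable M (\<lambda>z. (norm (f z))\<^sup>2)}"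

definition l2_inner :: "'z measure \<Rightarrow> ('z \<Rightarrow> complex) \<Rightarrow> ('z \<Rightarrow> complex) \<Rightarrow> complex" where
  "l2_inner M f g = (LINT z|M. f z * cnj (g z))"

definition l2_orthonormal :: "'z measure \<Rightarrow> ('r \<Rightarrow> 'z \<Rightarrow> complex) \<Rightarrow> bool" where
  "l2_orthonormal M X \<longleftrightarrow>
     (\<forall>i. X i \<in> L2 M) \<and> (\<forall>i j. l2_inner M (X i) (X j) = (if i = j then 1 else 0))"


section \<open>Curves in \<open>L\<^sup>2\<close>\<close>

text \<open>Derivative of a curve with respect to its real parameter, as a limit of difference quotients
  in the \<open>L\<^sup>2\<close> norm; at an end point of \<open>T\<close> it is one-sided. The membership conditions matter,
  because the integral of a non-integrable function is \<open>0\<close>.\<close>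

definition has_l2_deriv ::
  "'z measure \<Rightarrow> real set \<Rightarrow> (real \<Rightarrow> 'z \<Rightarrow> complex) \<Rightarrow> ('z \<Rightarrow> complex) \<Rightarrow> real \<Rightarrow> bool" where
  "has_l2_deriv M T f f' t \<longleftrightarrow>
     (\<forall>s\<in>T. f s \<in> L2 M) \<and> f' \<in> L2 M \<and>
     ((\<lambda>s. LINT z|M. (norm ((f s z - f t z) / of_real (s - t) - f' z))\<^sup>2) \<longlongrightarrow> 0) (at t within T)"

text \<open>The derivative is determined only up to null sets; a representative is chosen.\<close>

definition l2_deriv ::
  "'z measure \<Rightarrow> real set \<Rightarrow> (real \<Rightarrow> 'z \<Rightarrow> complex) \<Rightarrow> real \<Rightarrow> 'z \<Rightarrow> complex" where
  "l2_deriv M T f t = (SOME f'. has_l2_deriv M T f f' t)"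

definition l2_smooth :: "'z measure \<Rightarrow> real set \<Rightarrow> (real \<Rightarrow> 'z \<Rightarrow> complex) \<Rightarrow> bool" where
  "l2_smooth M T f \<longleftrightarrow>
     (\<exists>D :: nat \<Rightarrow> real \<Rightarrow> 'z \<Rightarrow> complex.
        D 0 = f \<and> (\<forall>k. \<forall>t\<in>T. has_l2_deriv M T (D k) (D (Suc k) t) t))"

definition smooth_curve :: "real set \<Rightarrow> (real \<Rightarrow> 'v::real_normed_vector) \<Rightarrow> bool" where
  "smooth_curve T f \<longleftrightarrow>
     (\<exists>D :: nat \<Rightarrow> real \<Rightarrow> 'v.
        D 0 = f \<and> (\<forall>k. \<forall>t\<in>T. (D k has_vector_derivative D (Suc k) t) (at t within T)))"


section \<open>The spaces in the variables \<open>x\<close>, \<open>\<xi>\<close> and \<open>(x, \<xi>)\<close>\<close>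

text \<open>The measures \<open>\<pi>(\<xi>) d\<xi>\<close> and \<open>\<pi>(\<xi>) dx d\<xi>\<close>. The inner products in \<open>x\<close>, in \<open>\<xi>\<close> and in
  \<open>(x, \<xi>)\<close> are \<open>l2_inner\<close> for \<open>lborel\<close>, \<open>xi_measure \<pi>\<close> and \<open>xxi_measure \<pi>\<close>.\<close>

definition xi_measure :: "(real^'n \<Rightarrow> real) \<Rightarrow> (real^'n) measure" where
  "xi_measure \<pi> = density lborel (\<lambda>\<xi>. ennreal (\<pi> \<xi>))"

definition xxi_measure :: "(real^'n \<Rightarrow> real) \<Rightarrow> ((real^'m) \<times> (real^'n)) measure" where
  "xxi_measure \<pi> = lborel \<Otimes>\<^sub>M xi_measure \<pi>"

text \<open>Inner products of a function of \<open>(x, \<xi>)\<close> with a function of one of the variables.\<close>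

definition partial_inner_x ::
  "((real^'m) \<times> (real^'n) \<Rightarrow> complex) \<Rightarrow> (real^'m \<Rightarrow> complex) \<Rightarrow> real^'n \<Rightarrow> complex" where
  "partial_inner_x \<psi> \<phi> \<xi> = l2_inner lborel (\<lambda>x. \<psi> (x, \<xi>)) \<phi>"

definition partial_inner_xi ::
  "(real^'n \<Rightarrow> real) \<Rightarrow> ((real^'m) \<times> (real^'n) \<Rightarrow> complex) \<Rightarrow> (real^'n \<Rightarrow> complex) \<Rightarrow> real^'m \<Rightarrow> complex" where
  "partial_inner_xi \<pi> \<psi> \<phi> x = l2_inner (xi_measure \<pi>) (\<lambda>\<xi>. \<psi> (x, \<xi>)) \<phi>"


section \<open>The low-rank manifold and its tangent spaces\<close>

text \<open>The rank \<open>r\<close> is the cardinality of the finite index type \<open>'r\<close>.\<close>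

definition low_rank_sum ::
  "('r::finite \<Rightarrow> real^'m \<Rightarrow> complex) \<Rightarrow> complex^'r^'r \<Rightarrow> ('r \<Rightarrow> real^'n \<Rightarrow> complex) \<Rightarrow>
   (real^'m) \<times> (real^'n) \<Rightarrow> complex" where
  "low_rank_sum X S W = (\<lambda>(x, \<xi>). \<Sum>i\<in>UNIV. \<Sum>j\<in>UNIV. X i x * S $ i $ j * W j \<xi>)"

definition low_rank_factors ::
  "(real^'n \<Rightarrow> real) \<Rightarrow> ('r::finite \<Rightarrow> real^'m \<Rightarrow> complex) \<Rightarrow> complex^'r^'r \<Rightarrow>
   ('r \<Rightarrow> real^'n \<Rightarrow> complex) \<Rightarrow> bool" where
  "low_rank_factors \<pi> X S W \<longleftrightarrow>
     l2_orthonormal lborel X \<and> l2_orthonormal (xi_measure \<pi>) W \<and> invertible S"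

definition low_rank_manifold ::
  "'r::finite itself \<Rightarrow> (real^'n \<Rightarrow> real) \<Rightarrow> ((real^'m) \<times> (real^'n) \<Rightarrow> complex) set" where
  "low_rank_manifold _ \<pi> =
     {low_rank_sum X S W | (X :: 'r \<Rightarrow> real^'m \<Rightarrow> complex) S W. low_rank_factors \<pi> X S W}"

definition smooth_low_rank_curve ::
  "(real^'n \<Rightarrow> real) \<Rightarrow> real set \<Rightarrow> (real \<Rightarrow> 'r::finite \<Rightarrow> real^'m \<Rightarrow> complex) \<Rightarrow>
   (real \<Rightarrow> complex^'r^'r) \<Rightarrow> (real \<Rightarrow> 'r \<Rightarrow> real^'n \<Rightarrow> complex) \<Rightarrow> bool" where
  "smooth_low_rank_curve \<pi> T X S W \<longleftrightarrow>
     (\<forall>i. l2_smooth lborel T (\<lambda>t. X t i)) \<and>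
     smooth_curve T S \<and>
     (\<forall>j. l2_smooth (xi_measure \<pi>) T (\<lambda>t. W t j)) \<and>
     (\<forall>t\<in>T. low_rank_factors \<pi> (X t) (S t) (W t))"

lemma smooth_low_rank_curve_in_manifold:
  fixes X :: "real \<Rightarrow> 'r::finite \<Rightarrow> real^'m \<Rightarrow> complex"
  assumes "smooth_low_rank_curve \<pi> T X S W" and "t \<in> T"
  shows "low_rank_sum (X t) (S t) (W t) \<in> low_rank_manifold TYPE('r) \<pi>"
  using assms unfolding smooth_low_rank_curve_def low_rank_manifold_def by blast

text \<open>The curve passes through \<open>\<psi>\<close> as a curve in \<open>L\<^sup>2\<close>; its factors at \<open>0\<close> need not be those of a
  given representation of \<open>\<psi>\<close>.\<close>

definition low_rank_tangent_space ::
  "'r::finite itself \<Rightarrow> (real^'n \<Rightarrow> real) \<Rightarrow> ((real^'m) \<times> (real^'n) \<Rightarrow> complex) \<Rightarrow>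
   ((real^'m) \<times> (real^'n) \<Rightarrow> complex) set" where
  "low_rank_tangent_space _ \<pi> \<psi> =
     {\<eta>. \<exists>\<delta>>0. \<exists>(X :: real \<Rightarrow> 'r \<Rightarrow> real^'m \<Rightarrow> complex) S W.
        smooth_low_rank_curve \<pi> {-\<delta><..<\<delta>} X S W \<and>
        (AE p in xxi_measure \<pi>. low_rank_sum (X 0) (S 0) (W 0) p = \<psi> p) \<and>
        has_l2_deriv (xxi_measure \<pi>) {-\<delta><..<\<delta>} (\<lambda>\<tau>. low_rank_sum (X \<tau>) (S \<tau>) (W \<tau>)) \<eta> 0}"


section \<open>The right-hand side of the Schroedinger equation\<close>

definition partial_deriv ::
  "'a::euclidean_space \<Rightarrow> ('a \<Rightarrow> complex) \<Rightarrow> 'a \<Rightarrow> complex" where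
  "partial_deriv b f x = vector_derivative (\<lambda>s. f (x + s *\<^sub>R b)) (at 0)"

definition laplacian :: "('a::euclidean_space \<Rightarrow> complex) \<Rightarrow> 'a \<Rightarrow> complex" where
  "laplacian f x = (\<Sum>b\<in>Basis. partial_deriv b (partial_deriv b f) x)"

text \<open>Existence of all the derivatives that occur in \<open>laplacian f\<close>.\<close>

definition has_laplacian :: "('a::euclidean_space \<Rightarrow> complex) \<Rightarrow> bool" where
  "has_laplacian f \<longleftrightarrow>
     (\<forall>x. \<forall>b\<in>Basis. (\<lambda>s::real. f (x + s *\<^sub>R b)) differentiable (at 0) \<and>
                   (\<lambda>s::real. partial_deriv b f (x + s *\<^sub>R b)) differentiable (at 0))"

definition schroedinger_rhs ::
  "real \<Rightarrow> (real^'m \<Rightarrow> real^'n \<Rightarrow> real) \<Rightarrow> ((real^'m) \<times> (real^'n) \<Rightarrow> complex) \<Rightarrow>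
   (real^'m) \<times> (real^'n) \<Rightarrow> complex" where
  "schroedinger_rhs \<epsilon> V \<psi> = (\<lambda>(x, \<xi>).
     1 / (\<i> * of_real \<epsilon>) *
       (- (of_real (\<epsilon>\<^sup>2) / 2) * laplacian (\<lambda>y. \<psi> (y, \<xi>)) x + of_real (V x \<xi>) * \<psi> (x, \<xi>)))"

end

theory Submission
  imports Defs
begin

text \<open>Write \<open>D\<close> for the residual \<open>\<partial>\<^sub>t\<psi> - F(\<psi>)\<close>. In the orthogonal gauge, pairing \<open>D\<close> with \<open>u(x) W\<^sub>j(\<xi>)\<close>
  or with \<open>X\<^sub>i(x) w(\<xi>)\<close> is the same as pairing the residual of the equation for \<open>X\<close> with \<open>u\<close>, or that
  of the equation for \<open>W\<close> with \<open>w\<close>. If \<open>D\<close> is orthogonal to the tangent space, moving \<open>S\<close> linearly and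
  rotating one \<open>X\<^sub>k\<close> or \<open>W\<^sub>k\<close> towards a unit vector orthogonal to all of them shows that these residuals are
  orthogonal both to the factors and to the complement of the factors, hence vanish; the normalised residual
  itself serves as the unit vector. Conversely, if the residuals vanish, then \<open>D\<close> is orthogonal to every
  \<open>u W\<^sub>j\<close> and \<open>X\<^sub>i w\<close>. A tangent vector may come from other factors \<open>X'\<close>, \<open>W'\<close> of the same \<open>\<psi>\<close>, but
  these span the same spaces, so \<open>D\<close> is orthogonal to it by the product rule.\<close>

section \<open>The inner product of \<open>L\<^sup>2\<close>\<close>

text \<open>The squared norm, not the norm, is the basic quantity: it is what
  \<open>has_l2_deriv\<close> sends to zero, and it avoids square roots throughout.\<close>

definition l2_sq :: "'z measure \<Rightarrow> ('z \<Rightarrow> complex) \<Rightarrow> real" where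
  "l2_sq M f = (LINT z|M. (norm (f z))\<^sup>2)"

lemma L2I:
  assumes "f \<in> borel_measurable M" and "integrable M (\<lambda>z. (norm (f z))\<^sup>2)"
  shows "f \<in> L2 M"
  using assms by (simp add: L2_def)

lemma L2_measurable [measurable_dest]: "f \<in> L2 M \<Longrightarrow> f \<in> borel_measurable M"
  by (simp add: L2_def)

lemma L2_integrable_sq: "f \<in> L2 M \<Longrightarrow> integrable M (\<lambda>z. (norm (f z))\<^sup>2)"
  by (simp add: L2_def)

lemma borel_measurable_cnj [measurable (raw)]:
  "f \<in> borel_measurable M \<Longrightarrow> (\<lambda>z. cnj (f z)) \<in> borel_measurable M"
  by (rule borel_measurable_continuous_on[OF continuous_on_cnj[OF continuous_on_id]])

text \<open>This follows from \<open>(norm a - norm b)\<^sup>2 \<ge> 0\<close> and plays the part of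
  the triangle inequality for squared norms. The factor 2 is harmless, since it only enters
  integrability and bounds tending to zero.\<close>

lemma norm_add_sq_le: "(norm (a + b))\<^sup>2 \<le> 2 * (norm a)\<^sup>2 + 2 * (norm b)\<^sup>2"
  for a b :: "'a::real_normed_vector"
proof -
  have "(norm (a + b))\<^sup>2 \<le> (norm a + norm b)\<^sup>2"
    by (simp add: norm_triangle_ineq power_mono)
  also have "\<dots> \<le> 2 * (norm a)\<^sup>2 + 2 * (norm b)\<^sup>2"
    using zero_le_power2[of "norm a - norm b"] by (simp add: power2_sum power2_diff)
  finally show ?thesis .
qed

lemma L2_add:
  assumes f: "f \<in> L2 M" and g: "g \<in> L2 M"
  shows "(\<lambda>z. f z + g z) \<in> L2 M"
proof (rule L2I)
  note [measurable] = f[THEN L2_measurable] g[THEN L2_measurable]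
  show "(\<lambda>z. f z + g z) \<in> borel_measurable M" by measurable
  have "integrable M (\<lambda>z. 2 * (norm (f z))\<^sup>2 + 2 * (norm (g z))\<^sup>2)"
    using f g by (simp add: L2_integrable_sq)
  then show "integrable M (\<lambda>z. (norm (f z + g z))\<^sup>2)"
    by (rule Bochner_Integration.integrable_bound) (auto intro!: AE_I2 norm_add_sq_le)
qed

lemma L2_cmul: "f \<in> L2 M \<Longrightarrow> (\<lambda>z. c * f z) \<in> L2 M"
  by (auto simp: L2_def norm_mult power_mult_distrib)

lemma L2_zero: "(\<lambda>z. 0) \<in> L2 M"
  by (simp add: L2_def)

lemma L2_diff: "f \<in> L2 M \<Longrightarrow> g \<in> L2 M \<Longrightarrow> (\<lambda>z. f z - g z) \<in> L2 M"
  using L2_add[of f M "\<lambda>z. (-1) * g z"] L2_cmul[of g M "-1"] by simp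

lemma L2_sum: "(\<And>i. i \<in> A \<Longrightarrow> f i \<in> L2 M) \<Longrightarrow> (\<lambda>z. \<Sum>i\<in>A. f i z) \<in> L2 M"
  by (induction A rule: infinite_finite_induct) (simp_all add: L2_zero L2_add)

lemmas L2_intros = L2_add L2_diff L2_cmul L2_zero L2_sum

lemma l2_sq_nonneg: "0 \<le> l2_sq M f"
  by (simp add: l2_sq_def)

lemma l2_sq_cmul: "l2_sq M (\<lambda>z. c * f z) = (norm c)\<^sup>2 * l2_sq M f"
  by (simp add: l2_sq_def norm_mult power_mult_distrib)

lemma l2_sq_add_le:
  assumes "f \<in> L2 M" and "g \<in> L2 M"
  shows "l2_sq M (\<lambda>z. f z + g z) \<le> 2 * l2_sq M f + 2 * l2_sq M g"
proof -
  have "l2_sq M (\<lambda>z. f z + g z) \<le> (LINT z|M. 2 * (norm (f z))\<^sup>2 + 2 * (norm (g z))\<^sup>2)"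
    unfolding l2_sq_def using assms
    by (intro integral_mono norm_add_sq_le) (simp_all add: L2_integrable_sq L2_add)
  then show ?thesis
    using assms by (simp add: l2_sq_def L2_integrable_sq)
qed

lemma l2_sq_eq_0_iff: "f \<in> L2 M \<Longrightarrow> l2_sq M f = 0 \<longleftrightarrow> (AE z in M. f z = 0)"
  unfolding l2_sq_def by (subst integral_nonneg_eq_0_iff_AE) (auto simp: L2_integrable_sq)

text \<open>Products are dominated by \<open>(norm a)\<^sup>2 + (norm b)\<^sup>2\<close>. Additivity
  of \<open>l2_inner\<close> rests on this, because the integral of a non-integrable product would
  be 0 by convention.\<close>

lemma integrable_mult_cnj:
  assumes f: "f \<in> L2 M" and g: "g \<in> L2 M"
  shows "integrable M (\<lambda>z. f z * cnj (g z))"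
proof -
  note [measurable] = f[THEN L2_measurable] g[THEN L2_measurable]
  have "integrable M (\<lambda>z. (norm (f z))\<^sup>2 + (norm (g z))\<^sup>2)"
    using f g by (simp add: L2_integrable_sq)
  then show ?thesis
  proof (rule Bochner_Integration.integrable_bound)
    have "norm a * norm b \<le> (norm a)\<^sup>2 + (norm b)\<^sup>2" for a b :: complex
      using sum_squares_bound[of "norm a" "norm b"] mult_nonneg_nonneg[OF norm_ge_zero norm_ge_zero, of a b]
      by linarith
    then show "AE z in M. norm (f z * cnj (g z)) \<le> norm ((norm (f z))\<^sup>2 + (norm (g z))\<^sup>2)"
      by (intro AE_I2) (simp add: norm_mult)
  qed measurable
qed

lemma l2_inner_add_left:
  "f \<in> L2 M \<Longrightarrow> g \<in> L2 M \<Longrightarrow> h \<in> L2 M \<Longrightarrow>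
    l2_inner M (\<lambda>z. f z + g z) h = l2_inner M f h + l2_inner M g h"
  by (simp add: l2_inner_def distrib_right integrable_mult_cnj)

lemma l2_inner_diff_left:
  "f \<in> L2 M \<Longrightarrow> g \<in> L2 M \<Longrightarrow> h \<in> L2 M \<Longrightarrow>
    l2_inner M (\<lambda>z. f z - g z) h = l2_inner M f h - l2_inner M g h"
  by (simp add: l2_inner_def left_diff_distrib integrable_mult_cnj)

lemma l2_inner_cmul_left: "l2_inner M (\<lambda>z. c * f z) h = c * l2_inner M f h"
  by (simp add: l2_inner_def mult.assoc)

lemma l2_inner_zero_left: "l2_inner M (\<lambda>z. 0) h = 0"
  by (simp add: l2_inner_def)

lemma l2_inner_sum_left:
  "(\<And>i. i \<in> A \<Longrightarrow> f i \<in> L2 M) \<Longrightarrow> h \<in> L2 M \<Longrightarrow>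
    l2_inner M (\<lambda>z. \<Sum>i\<in>A. f i z) h = (\<Sum>i\<in>A. l2_inner M (f i) h)"
  by (induction A rule: infinite_finite_induct)
    (simp_all add: l2_inner_zero_left l2_inner_add_left L2_sum)

lemma cnj_l2_inner: "cnj (l2_inner M f g) = l2_inner M g f"
  using Bochner_Integration.integral_cnj[of M "\<lambda>z. f z * cnj (g z)"] by (simp add: l2_inner_def mult.commute)

lemma l2_inner_add_right:
  "f \<in> L2 M \<Longrightarrow> g \<in> L2 M \<Longrightarrow> h \<in> L2 M \<Longrightarrow>
    l2_inner M h (\<lambda>z. f z + g z) = l2_inner M h f + l2_inner M h g"
  by (subst (1 2 3) cnj_l2_inner[symmetric]) (simp add: l2_inner_add_left)

lemma l2_inner_cmul_right: "l2_inner M h (\<lambda>z. c * f z) = cnj c * l2_inner M h f"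
  by (subst (1 2) cnj_l2_inner[symmetric]) (simp add: l2_inner_cmul_left)

lemma l2_inner_zero_right: "l2_inner M h (\<lambda>z. 0) = 0"
  by (simp add: l2_inner_def)

lemma l2_inner_sum_right:
  "(\<And>i. i \<in> A \<Longrightarrow> f i \<in> L2 M) \<Longrightarrow> h \<in> L2 M \<Longrightarrow>
    l2_inner M h (\<lambda>z. \<Sum>i\<in>A. f i z) = (\<Sum>i\<in>A. l2_inner M h (f i))"
  by (induction A rule: infinite_finite_induct)
    (simp_all add: l2_inner_zero_right l2_inner_add_right L2_sum)

lemma l2_inner_self: "l2_inner M f f = of_real (l2_sq M f)"
  unfolding l2_inner_def l2_sq_def
  by (subst integral_complex_of_real[symmetric])
    (intro Bochner_Integration.integral_cong refl, simp add: complex_norm_square[symmetric])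

text \<open>Representatives may be exchanged in both slots. Measurability is asked of all four
  functions because the measure need not be complete.\<close>

lemma l2_inner_cong_AE:
  assumes "AE z in M. f z = f' z" and "AE z in M. g z = g' z"
    and [measurable]: "f \<in> borel_measurable M" "f' \<in> borel_measurable M"
      "g \<in> borel_measurable M" "g' \<in> borel_measurable M"
  shows "l2_inner M f g = l2_inner M f' g'"
  unfolding l2_inner_def by (rule integral_cong_AE) (use assms in auto)

text \<open>Subtracting from \<open>f\<close> its projection onto \<open>g\<close> leaves a vector
  whose squared norm, which is nonnegative, is exactly the gap in the inequality divided by
  \<open>l2_sq M g\<close>. A null \<open>g\<close> is treated apart because of that
  division.\<close>

lemma l2_Cauchy_Schwarz:
  assumes f: "f \<in> L2 M" and g: "g \<in> L2 M"
  shows "(norm (l2_inner M f g))\<^sup>2 \<le> l2_sq M f * l2_sq M g"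
proof (cases "l2_sq M g = 0")
  case True
  then have "AE z in M. g z = 0" using g by (simp add: l2_sq_eq_0_iff)
  then have "l2_inner M f g = l2_inner M f (\<lambda>z. 0)"
    by (intro l2_inner_cong_AE) (use f g in \<open>auto intro: L2_measurable\<close>)
  then show ?thesis by (simp add: True l2_inner_zero_right)
next
  case False
  then have pos: "0 < l2_sq M g" using l2_sq_nonneg[of M g] by simp
  define a where "a = l2_inner M f g"
  \<comment> \<open>The coefficient of the orthogonal projection of \<open>f\<close> onto
    \<open>g\<close>.\<close>
  define c where "c = a / of_real (l2_sq M g)"
  define h where "h = (\<lambda>z. f z - c * g z)"
  have h: "h \<in> L2 M" unfolding h_def by (intro L2_intros f g)
  have hg: "l2_inner M h g = 0"
    unfolding h_def using f g pos
    by (simp add: l2_inner_diff_left L2_cmul l2_inner_cmul_left l2_inner_self)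
      (simp add: c_def a_def)
  \<comment> \<open>Only the second copy of \<open>h\<close> is expanded at first; its
    \<open>g\<close> part drops out because \<open>h\<close> is orthogonal to
    \<open>g\<close>.\<close>
  have "of_real (l2_sq M h) = l2_inner M h (\<lambda>z. f z + (- c) * g z)"
    by (simp add: l2_inner_self[symmetric] h_def)
  also have "\<dots> = l2_inner M h f - cnj c * l2_inner M h g"
    by (subst l2_inner_add_right, intro f, intro L2_cmul g, rule h)
      (simp only: l2_inner_cmul_right, simp)
  also have "\<dots> = l2_inner M h f" by (simp add: hg)
  also have "\<dots> = of_real (l2_sq M f) - c * cnj a"
    unfolding h_def a_def using f g
    by (simp add: l2_inner_diff_left L2_cmul l2_inner_cmul_left l2_inner_self cnj_l2_inner)
  also have "c * cnj a = of_real ((norm a)\<^sup>2 / l2_sq M g)"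
    by (simp add: c_def complex_norm_square del: of_real_power)
  finally have "l2_sq M h = l2_sq M f - (norm a)\<^sup>2 / l2_sq M g"
    by (metis of_real_diff of_real_eq_iff)
  with l2_sq_nonneg[of M h] have "(norm a)\<^sup>2 / l2_sq M g \<le> l2_sq M f" by simp
  then show ?thesis using pos by (simp add: a_def divide_le_eq)
qed

section \<open>Derivatives of curves in \<open>L\<^sup>2\<close>\<close>

lemma has_l2_derivD:
  assumes "has_l2_deriv M T f f' t"
  shows "s \<in> T \<Longrightarrow> f s \<in> L2 M" and "f' \<in> L2 M"
    and "((\<lambda>s. l2_sq M (\<lambda>z. (f s z - f t z) / of_real (s - t) - f' z)) \<longlongrightarrow> 0) (at t within T)"
  using assms unfolding has_l2_deriv_def l2_sq_def by auto

text \<open>The calculus rules below control the squared error only from above, so derivatives are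
  established by squeezing.\<close>

lemma has_l2_derivI_bound:
  assumes "\<And>s. s \<in> T \<Longrightarrow> f s \<in> L2 M" and "f' \<in> L2 M"
    and bound: "\<And>s. s \<in> T \<Longrightarrow> s \<noteq> t \<Longrightarrow>
      l2_sq M (\<lambda>z. (f s z - f t z) / of_real (s - t) - f' z) \<le> b s"
    and b: "(b \<longlongrightarrow> 0) (at t within T)"
  shows "has_l2_deriv M T f f' t"
proof -
  have "((\<lambda>s. l2_sq M (\<lambda>z. (f s z - f t z) / of_real (s - t) - f' z)) \<longlongrightarrow> 0) (at t within T)"
    by (rule tendsto_sandwich[OF _ _ tendsto_const b])
      (auto simp: l2_sq_nonneg eventually_at_filter bound simp del: of_real_diff)
  then show ?thesis using assms by (simp add: has_l2_deriv_def l2_sq_def)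
qed

lemma L2_divide: "f \<in> L2 M \<Longrightarrow> (\<lambda>z. f z / c) \<in> L2 M"
  using L2_cmul[of f M "inverse c"] by (simp add: field_class.field_divide_inverse mult.commute)

text \<open>Both candidates are close to the same difference quotient, so the squared distance
  between them is below a bound tending to 0. The filter must be nontrivial, or the limits would say
  nothing.\<close>

lemma has_l2_deriv_unique:
  assumes f': "has_l2_deriv M T f f' t" and f'': "has_l2_deriv M T f f'' t"
    and t: "t \<in> T" "at t within T \<noteq> bot"
  shows "AE z in M. f' z = f'' z"
proof -
  define q where "q = (\<lambda>s z. (f s z - f t z) / of_real (s - t))"
  have q: "q s \<in> L2 M" if "s \<in> T" for s
    unfolding q_def using that t has_l2_derivD(1)[OF f'] by (intro L2_divide L2_diff) auto
  note d = has_l2_derivD(2)[OF f'] has_l2_derivD(2)[OF f'']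
  define b where "b = (\<lambda>s. 2 * l2_sq M (\<lambda>z. q s z - f' z) + 2 * l2_sq M (\<lambda>z. q s z - f'' z))"
  have "(b \<longlongrightarrow> 2 * 0 + 2 * 0) (at t within T)"
    unfolding b_def q_def by (intro tendsto_intros has_l2_derivD(3) f' f'')
  then have b0: "(b \<longlongrightarrow> 0) (at t within T)" by simp
  have le: "l2_sq M (\<lambda>z. f' z - f'' z) \<le> b s" if "s \<in> T" for s
  proof -
    have "l2_sq M (\<lambda>z. (q s z - f'' z) + (-1) * (q s z - f' z))
      \<le> 2 * l2_sq M (\<lambda>z. q s z - f'' z) + 2 * l2_sq M (\<lambda>z. (-1) * (q s z - f' z))"
      by (rule l2_sq_add_le) (intro L2_intros q d that)+
    then show ?thesis by (simp only: l2_sq_cmul b_def) (simp add: algebra_simps)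
  qed
  have "l2_sq M (\<lambda>z. f' z - f'' z) \<le> 0"
    using le by (intro tendsto_lowerbound[OF b0 _ t(2)]) (auto simp: eventually_at_filter)
  then have "l2_sq M (\<lambda>z. f' z - f'' z) = 0"
    using l2_sq_nonneg[of M "\<lambda>z. f' z - f'' z"] by simp
  then show ?thesis by (simp add: l2_sq_eq_0_iff L2_diff d)
qed

lemma has_l2_deriv_l2_deriv:
  "has_l2_deriv M T f f' t \<Longrightarrow> has_l2_deriv M T f (l2_deriv M T f t) t"
  unfolding l2_deriv_def by (rule someI[where P = "\<lambda>f'. has_l2_deriv M T f f' t"])

text \<open>The increment is \<open>s - t\<close> times a difference quotient whose norm stays
  bounded near \<open>t\<close>.\<close>

lemma has_l2_deriv_continuous:
  assumes f: "has_l2_deriv M T f f' t" and t: "t \<in> T"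
  shows "((\<lambda>s. l2_sq M (\<lambda>z. f s z - f t z)) \<longlongrightarrow> 0) (at t within T)"
proof -
  define q where "q = (\<lambda>s z. (f s z - f t z) / of_real (s - t))"
  define b where "b = (\<lambda>s. (norm (complex_of_real (s - t)))\<^sup>2 * (2 * l2_sq M (\<lambda>z. q s z - f' z) + 2 * l2_sq M f'))"
  have "(b \<longlongrightarrow> (norm (complex_of_real (t - t)))\<^sup>2 * (2 * 0 + 2 * l2_sq M f')) (at t within T)"
    unfolding b_def q_def by (intro tendsto_intros has_l2_derivD(3) f)
  then have b0: "(b \<longlongrightarrow> 0) (at t within T)" by simp
  have le: "l2_sq M (\<lambda>z. f s z - f t z) \<le> b s" if s: "s \<in> T" for s
  proof -
    have q: "q s \<in> L2 M"
      unfolding q_def using s t has_l2_derivD(1)[OF f] by (intro L2_divide L2_diff) auto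
    \<comment> \<open>This also holds at \<open>s = t\<close>, where both sides are 0 whatever value
      the quotient has.\<close>
    have "(\<lambda>z. f s z - f t z) = (\<lambda>z. complex_of_real (s - t) * ((q s z - f' z) + f' z))"
      by (auto simp: q_def fun_eq_iff)
    then have "l2_sq M (\<lambda>z. f s z - f t z)
      = (norm (complex_of_real (s - t)))\<^sup>2 * l2_sq M (\<lambda>z. (q s z - f' z) + f' z)"
      by (simp only: l2_sq_cmul)
    also have "\<dots> \<le> b s"
      unfolding b_def by (intro mult_left_mono l2_sq_add_le L2_diff q has_l2_derivD(2)[OF f]) simp
    finally show ?thesis .
  qed
  show ?thesis
    by (rule tendsto_sandwich[OF _ _ tendsto_const b0]) (auto simp: l2_sq_nonneg eventually_at_filter le)
qed

section \<open>Sum and product rules for curves in \<open>L2\<close>\<close>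

lemma has_l2_deriv_const: "f \<in> L2 M \<Longrightarrow> has_l2_deriv M T (\<lambda>s. f) (\<lambda>z. 0) t"
  by (rule has_l2_derivI_bound[where b = "\<lambda>s. 0"]) (auto simp: L2_zero l2_sq_def)

lemma has_l2_deriv_add:
  assumes f: "has_l2_deriv M T f f' t" and g: "has_l2_deriv M T g g' t" and t: "t \<in> T"
  shows "has_l2_deriv M T (\<lambda>s z. f s z + g s z) (\<lambda>z. f' z + g' z) t"
proof (rule has_l2_derivI_bound)
  note d = has_l2_derivD(1)[OF f] has_l2_derivD(1)[OF g] has_l2_derivD(2)[OF f] has_l2_derivD(2)[OF g]
  show "(\<lambda>z. f s z + g s z) \<in> L2 M" if "s \<in> T" for s
    by (intro L2_add d that)
  show "(\<lambda>z. f' z + g' z) \<in> L2 M"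
    by (intro L2_add d)
  show "l2_sq M (\<lambda>z. (f s z + g s z - (f t z + g t z)) / of_real (s - t) - (f' z + g' z))
    \<le> 2 * l2_sq M (\<lambda>z. (f s z - f t z) / of_real (s - t) - f' z)
      + 2 * l2_sq M (\<lambda>z. (g s z - g t z) / of_real (s - t) - g' z)" if "s \<in> T" for s
  proof -
    have "(\<lambda>z. (f s z + g s z - (f t z + g t z)) / of_real (s - t) - (f' z + g' z))
      = (\<lambda>z. ((f s z - f t z) / of_real (s - t) - f' z) + ((g s z - g t z) / of_real (s - t) - g' z))"
      by (simp add: fun_eq_iff diff_divide_distrib add_divide_distrib)
    then show ?thesis
      by (simp only:) (intro l2_sq_add_le L2_diff L2_divide d that t)
  qed
  show "((\<lambda>s. 2 * l2_sq M (\<lambda>z. (f s z - f t z) / of_real (s - t) - f' z)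
      + 2 * l2_sq M (\<lambda>z. (g s z - g t z) / of_real (s - t) - g' z)) \<longlongrightarrow> 0) (at t within T)"
    using tendsto_add[OF tendsto_mult[OF tendsto_const has_l2_derivD(3)[OF f], of 2]
        tendsto_mult[OF tendsto_const has_l2_derivD(3)[OF g], of 2]] by simp
qed

lemma has_l2_deriv_sum:
  assumes "\<And>i. i \<in> A \<Longrightarrow> has_l2_deriv M T (f i) (f' i) t" and "t \<in> T"
  shows "has_l2_deriv M T (\<lambda>s z. \<Sum>i\<in>A. f i s z) (\<lambda>z. \<Sum>i\<in>A. f' i z) t"
  using assms
proof (induction A rule: infinite_finite_induct)
  case (insert i A)
  then have "has_l2_deriv M T (\<lambda>s z. f i s z + (\<Sum>i\<in>A. f i s z)) (\<lambda>z. f' i z + (\<Sum>i\<in>A. f' i z)) t"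
    by (intro has_l2_deriv_add) auto
  with insert show ?case by simp
qed (auto intro: has_l2_deriv_const L2_zero)

lemma l2_sq_add3_le:
  assumes "f \<in> L2 M" and "g \<in> L2 M" and "h \<in> L2 M"
  shows "l2_sq M (\<lambda>z. f z + g z + h z) \<le> 4 * l2_sq M f + 4 * l2_sq M g + 2 * l2_sq M h"
  using l2_sq_add_le[OF L2_add[OF assms(1,2)] assms(3)] l2_sq_add_le[OF assms(1,2)] by simp

text \<open>The algebra behind both product rules, with \<open>a'\<close>, \<open>b'\<close> the
  values at the base point and \<open>p\<close>, \<open>q\<close> the derivatives there. Each of the
  three terms has one factor that tends to zero.\<close>

lemma difference_quotient_mult:
  fixes h :: "'a::field"
  assumes "h \<noteq> 0"
  shows "(a * b - a' * b') / h - (p * b' + a' * q)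
    = ((a - a') / h - p) * b + p * (b - b') + a' * ((b - b') / h - q)"
  using assms by (simp add: field_simps)

lemma has_l2_deriv_cmul:
  assumes a: "(a has_vector_derivative a') (at t within T)"
    and f: "has_l2_deriv M T f f' t" and t: "t \<in> T"
  shows "has_l2_deriv M T (\<lambda>s z. a s * f s z) (\<lambda>z. a' * f t z + a t * f' z) t"
proof (rule has_l2_derivI_bound)
  note d = has_l2_derivD(1)[OF f] has_l2_derivD(2)[OF f]
  let ?p = "\<lambda>s. (a s - a t) / of_real (s - t) - a'"
  let ?q = "\<lambda>s z. (f s z - f t z) / of_real (s - t) - f' z"
  \<comment> \<open>The three terms of \<open>difference_quotient_mult\<close> give this bound. The
    norm of \<open>f s\<close> is replaced by norms of \<open>f s - f t\<close> and
    \<open>f t\<close>, so that the limit can be read off termwise.\<close>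
  let ?b = "\<lambda>s. 4 * ((norm (?p s))\<^sup>2 * (2 * l2_sq M (\<lambda>z. f s z - f t z) + 2 * l2_sq M (f t)))
    + 4 * ((norm a')\<^sup>2 * l2_sq M (\<lambda>z. f s z - f t z)) + 2 * ((norm (a t))\<^sup>2 * l2_sq M (?q s))"
  show "(\<lambda>z. a s * f s z) \<in> L2 M" if "s \<in> T" for s
    by (intro L2_intros d that)
  show "(\<lambda>z. a' * f t z + a t * f' z) \<in> L2 M"
    by (intro L2_intros d t)
  show "l2_sq M (\<lambda>z. (a s * f s z - a t * f t z) / of_real (s - t) - (a' * f t z + a t * f' z)) \<le> ?b s"
    if s: "s \<in> T" "s \<noteq> t" for s
  proof -
    have "(\<lambda>z. (a s * f s z - a t * f t z) / of_real (s - t) - (a' * f t z + a t * f' z))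
      = (\<lambda>z. ?p s * f s z + a' * (f s z - f t z) + a t * ?q s z)"
      using s by (intro ext difference_quotient_mult) simp
    then have "l2_sq M (\<lambda>z. (a s * f s z - a t * f t z) / of_real (s - t) - (a' * f t z + a t * f' z))
      \<le> 4 * l2_sq M (\<lambda>z. ?p s * f s z) + 4 * l2_sq M (\<lambda>z. a' * (f s z - f t z))
        + 2 * l2_sq M (\<lambda>z. a t * ?q s z)"
      by (simp only:) (intro l2_sq_add3_le L2_intros L2_divide d s t)
    also have "\<dots> = 4 * ((norm (?p s))\<^sup>2 * l2_sq M (f s))
        + 4 * ((norm a')\<^sup>2 * l2_sq M (\<lambda>z. f s z - f t z)) + 2 * ((norm (a t))\<^sup>2 * l2_sq M (?q s))"
      by (simp only: l2_sq_cmul)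
    also have "\<dots> \<le> ?b s"
      using l2_sq_add_le[OF L2_diff[OF d(1)[OF s(1)] d(1)[OF t]] d(1)[OF t]]
      by (intro add_right_mono mult_left_mono) simp_all
    finally show ?thesis .
  qed
  \<comment> \<open>The derivative of the scalar curve is restated for the complex quotient
    \<open>?p\<close>, which divides by \<open>of_real (s - t)\<close> where the library scales by a
    real.\<close>
  have "((\<lambda>s. norm (a s - a t - (s - t) *\<^sub>R a') / norm (s - t)) \<longlongrightarrow> 0) (at t within T)"
    using a by (simp add: has_vector_derivative_def has_derivative_iff_norm)
  moreover
  have "norm (a s - a t - (s - t) *\<^sub>R a') / norm (s - t) = norm (?p s)" if "s \<noteq> t" for s
  proof -
    have "norm (?p s) = norm ((a s - a t - (s - t) *\<^sub>R a') / of_real (s - t))"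
      using that by (simp add: diff_divide_distrib scaleR_conv_of_real del: of_real_diff)
    then show ?thesis
      by (simp only: norm_divide norm_of_real real_norm_def)
  qed
  then have "\<forall>\<^sub>F s in at t within T. norm (a s - a t - (s - t) *\<^sub>R a') / norm (s - t) = norm (?p s)"
    by (auto simp: eventually_at_filter simp del: of_real_diff)
  ultimately have "((\<lambda>s. norm (?p s)) \<longlongrightarrow> 0) (at t within T)"
    by (rule Lim_transform_eventually)
  then have "(?b \<longlongrightarrow> 4 * (0\<^sup>2 * (2 * 0 + 2 * l2_sq M (f t)))
    + 4 * ((norm a')\<^sup>2 * 0) + 2 * ((norm (a t))\<^sup>2 * 0)) (at t within T)"
    by (intro tendsto_intros has_l2_derivD(3)[OF f] has_l2_deriv_continuous[OF f t])
  then show "(?b \<longlongrightarrow> 0) (at t within T)" by simp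
qed

section \<open>Tensor products\<close>

definition tensor :: "('a \<Rightarrow> complex) \<Rightarrow> ('b \<Rightarrow> complex) \<Rightarrow> 'a \<times> 'b \<Rightarrow> complex" where
  "tensor u w = (\<lambda>(x, y). u x * w y)"

section \<open>Fubini for elementary tensors and partial inner products\<close>

context pair_sigma_finite
begin

text \<open>The scalar type is generic because both real squared norms and complex products are
  integrated in this way.\<close>

lemma integrable_tensor:
  fixes f g :: "_ \<Rightarrow> 'c::{real_normed_field, banach, second_countable_topology}"
  assumes f: "integrable M1 f" and g: "integrable M2 g"
  shows "integrable (M1 \<Otimes>\<^sub>M M2) (\<lambda>(x, y). f x * g y)"
proof (rule Fubini_integrable)
  have [measurable]: "f \<in> borel_measurable M1" "g \<in> borel_measurable M2"
    using assms by auto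
  show "(\<lambda>(x, y). f x * g y) \<in> borel_measurable (M1 \<Otimes>\<^sub>M M2)"
    by measurable
  show "integrable M1 (\<lambda>x. LINT y|M2. norm (case (x, y) of (x, y) \<Rightarrow> f x * g y))"
    using f by (simp add: norm_mult)
  show "AE x in M1. integrable M2 (\<lambda>y. case (x, y) of (x, y) \<Rightarrow> f x * g y)"
    using g by simp
qed

lemma integral_tensor:
  fixes f g :: "_ \<Rightarrow> 'c::{real_normed_field, banach, second_countable_topology}"
  assumes f: "integrable M1 f" and g: "integrable M2 g"
  shows "(LINT (x, y)|(M1 \<Otimes>\<^sub>M M2). f x * g y) = (LINT x|M1. f x) * (LINT y|M2. g y)"
  using integral_fst'[OF integrable_tensor[OF assms]] by simp

lemma L2_tensor:
  assumes u: "u \<in> L2 M1" and w: "w \<in> L2 M2"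
  shows "tensor u w \<in> L2 (M1 \<Otimes>\<^sub>M M2)"
proof (rule L2I)
  note [measurable] = u[THEN L2_measurable] w[THEN L2_measurable]
  show "tensor u w \<in> borel_measurable (M1 \<Otimes>\<^sub>M M2)"
    unfolding tensor_def by measurable
  show "integrable (M1 \<Otimes>\<^sub>M M2) (\<lambda>p. (norm (tensor u w p))\<^sup>2)"
    using integrable_tensor[OF u[THEN L2_integrable_sq] w[THEN L2_integrable_sq]]
    by (simp add: tensor_def norm_mult power_mult_distrib case_prod_unfold)
qed

lemma l2_sq_tensor:
  assumes u: "u \<in> L2 M1" and w: "w \<in> L2 M2"
  shows "l2_sq (M1 \<Otimes>\<^sub>M M2) (tensor u w) = l2_sq M1 u * l2_sq M2 w"
  using integral_tensor[OF u[THEN L2_integrable_sq] w[THEN L2_integrable_sq]]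
  by (simp add: l2_sq_def tensor_def norm_mult power_mult_distrib case_prod_unfold)

lemma l2_inner_tensor:
  assumes "u \<in> L2 M1" and "w \<in> L2 M2" and "u' \<in> L2 M1" and "w' \<in> L2 M2"
  shows "l2_inner (M1 \<Otimes>\<^sub>M M2) (tensor u w) (tensor u' w') = l2_inner M1 u u' * l2_inner M2 w w'"
  using integral_tensor[OF integrable_mult_cnj[OF assms(1,3)] integrable_mult_cnj[OF assms(2,4)]]
  by (simp add: l2_inner_def tensor_def case_prod_unfold mult_ac)

text \<open>The argument for \<open>has_l2_deriv_cmul\<close> again: each of the three error terms
  is itself an elementary tensor, so \<open>l2_sq_tensor\<close> splits its squared norm into a
  product.\<close>

lemma has_l2_deriv_tensor:
  assumes u: "has_l2_deriv M1 T u u' t" and w: "has_l2_deriv M2 T w w' t" and t: "t \<in> T"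
  shows "has_l2_deriv (M1 \<Otimes>\<^sub>M M2) T (\<lambda>s. tensor (u s) (w s))
    (\<lambda>p. tensor u' (w t) p + tensor (u t) w' p) t"
proof (rule has_l2_derivI_bound)
  note d = has_l2_derivD(1)[OF u] has_l2_derivD(2)[OF u] has_l2_derivD(1)[OF w] has_l2_derivD(2)[OF w]
  let ?p = "\<lambda>s x. (u s x - u t x) / of_real (s - t) - u' x"
  let ?q = "\<lambda>s y. (w s y - w t y) / of_real (s - t) - w' y"
  let ?b = "\<lambda>s. 4 * (l2_sq M1 (?p s) * (2 * l2_sq M2 (\<lambda>y. w s y - w t y) + 2 * l2_sq M2 (w t)))
    + 4 * (l2_sq M1 u' * l2_sq M2 (\<lambda>y. w s y - w t y)) + 2 * (l2_sq M1 (u t) * l2_sq M2 (?q s))"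
  show "tensor (u s) (w s) \<in> L2 (M1 \<Otimes>\<^sub>M M2)" if "s \<in> T" for s
    by (intro L2_tensor d that)
  show "(\<lambda>p. tensor u' (w t) p + tensor (u t) w' p) \<in> L2 (M1 \<Otimes>\<^sub>M M2)"
    by (intro L2_add L2_tensor d t)
  let ?g = "\<lambda>s p. (tensor (u s) (w s) p - tensor (u t) (w t) p) / of_real (s - t)
    - (tensor u' (w t) p + tensor (u t) w' p)"
  show "l2_sq (M1 \<Otimes>\<^sub>M M2) (?g s) \<le> ?b s" if s: "s \<in> T" "s \<noteq> t" for s
  proof -
    have "?g s = (\<lambda>p. tensor (?p s) (w s) p + tensor u' (\<lambda>y. w s y - w t y) p + tensor (u t) (?q s) p)"
      using s by (auto simp: fun_eq_iff tensor_def intro!: difference_quotient_mult simp del: of_real_diff)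
    then have "l2_sq (M1 \<Otimes>\<^sub>M M2) (?g s)
      \<le> 4 * l2_sq (M1 \<Otimes>\<^sub>M M2) (tensor (?p s) (w s))
        + 4 * l2_sq (M1 \<Otimes>\<^sub>M M2) (tensor u' (\<lambda>y. w s y - w t y))
        + 2 * l2_sq (M1 \<Otimes>\<^sub>M M2) (tensor (u t) (?q s))"
      by (simp only:) (intro l2_sq_add3_le L2_intros L2_divide L2_tensor d s t)
    also have "\<dots> = 4 * (l2_sq M1 (?p s) * l2_sq M2 (w s))
        + 4 * (l2_sq M1 u' * l2_sq M2 (\<lambda>y. w s y - w t y)) + 2 * (l2_sq M1 (u t) * l2_sq M2 (?q s))"
      by (intro arg_cong2[where f = "(+)"] arg_cong2[where f = "(*)"] refl l2_sq_tensor
          L2_intros L2_divide d s t)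
    also have "\<dots> \<le> ?b s"
      using l2_sq_add_le[OF L2_diff[OF d(3)[OF s(1)] d(3)[OF t]] d(3)[OF t]]
      by (intro add_right_mono mult_left_mono) (simp_all add: l2_sq_nonneg)
    finally show ?thesis .
  qed
  have "(?b \<longlongrightarrow> 4 * (0 * (2 * 0 + 2 * l2_sq M2 (w t)))
    + 4 * (l2_sq M1 u' * 0) + 2 * (l2_sq M1 (u t) * 0)) (at t within T)"
    by (intro tendsto_intros has_l2_derivD(3)[OF u] has_l2_derivD(3)[OF w] has_l2_deriv_continuous[OF w t])
  then show "(?b \<longlongrightarrow> 0) (at t within T)" by simp
qed

text \<open>Cauchy-Schwarz on the slices bounds the squared partial inner product by
  \<open>l2_sq M2 (\<lambda>y. D (x, y)) * l2_sq M2 w\<close>, which is integrable in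
  \<open>x\<close>. The second claim is Fubini. The partial inner product thus represents the
  functional obtained by fixing \<open>w\<close>.\<close>

lemma partial_l2_inner_snd:
  assumes D: "D \<in> L2 (M1 \<Otimes>\<^sub>M M2)" and w: "w \<in> L2 M2"
  shows "(\<lambda>x. l2_inner M2 (\<lambda>y. D (x, y)) w) \<in> L2 M1"
    and "u \<in> L2 M1 \<Longrightarrow> l2_inner (M1 \<Otimes>\<^sub>M M2) D (tensor u w)
      = l2_inner M1 (\<lambda>x. l2_inner M2 (\<lambda>y. D (x, y)) w) u"
proof -
  note [measurable] = D[THEN L2_measurable] w[THEN L2_measurable]
  have m: "(\<lambda>x. l2_inner M2 (\<lambda>y. D (x, y)) w) \<in> borel_measurable M1"
    unfolding l2_inner_def by measurable
  show "(\<lambda>x. l2_inner M2 (\<lambda>y. D (x, y)) w) \<in> L2 M1"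
  proof (rule L2I[OF m])
    have "integrable M1 (\<lambda>x. l2_sq M2 (\<lambda>y. D (x, y)) * l2_sq M2 w)"
      using integrable_fst'[OF L2_integrable_sq[OF D]] by (simp add: l2_sq_def)
    moreover have "AE x in M1. norm ((norm (l2_inner M2 (\<lambda>y. D (x, y)) w))\<^sup>2)
        \<le> norm (l2_sq M2 (\<lambda>y. D (x, y)) * l2_sq M2 w)"
      \<comment> \<open>Square integrability of the slice is known only for almost every
        \<open>x\<close>, so the bound is an almost-everywhere one.\<close>
      using AE_integrable_fst'[OF L2_integrable_sq[OF D]] AE_space
    proof eventually_elim
      case (elim x)
      then have "(\<lambda>y. D (x, y)) \<in> L2 M2"
        by (intro L2I) measurable
      then show ?case
        using l2_Cauchy_Schwarz[OF _ w, of "\<lambda>y. D (x, y)"] by (simp add: l2_sq_nonneg)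
    qed
    moreover have "(\<lambda>x. (norm (l2_inner M2 (\<lambda>y. D (x, y)) w))\<^sup>2) \<in> borel_measurable M1"
      using m by measurable
    ultimately show "integrable M1 (\<lambda>x. (norm (l2_inner M2 (\<lambda>y. D (x, y)) w))\<^sup>2)"
      using Bochner_Integration.integrable_bound by blast
  qed
  assume u: "u \<in> L2 M1"
  show "l2_inner (M1 \<Otimes>\<^sub>M M2) D (tensor u w)
      = l2_inner M1 (\<lambda>x. l2_inner M2 (\<lambda>y. D (x, y)) w) u"
    using integral_fst'[OF integrable_mult_cnj[OF D L2_tensor[OF u w]]]
    by (simp add: l2_inner_def tensor_def mult.commute mult.left_commute flip: integral_mult_right_zero)
qed

text \<open>Swapping the coordinates reduces this to the previous lemma on
  \<open>M2 \<Otimes>\<^sub>M M1\<close>.\<close>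

lemma partial_l2_inner_fst:
  assumes D: "D \<in> L2 (M1 \<Otimes>\<^sub>M M2)" and u: "u \<in> L2 M1"
  shows "(\<lambda>y. l2_inner M1 (\<lambda>x. D (x, y)) u) \<in> L2 M2"
    and "w \<in> L2 M2 \<Longrightarrow> l2_inner (M1 \<Otimes>\<^sub>M M2) D (tensor u w)
      = l2_inner M2 (\<lambda>y. l2_inner M1 (\<lambda>x. D (x, y)) u) w"
proof -
  interpret Q: pair_sigma_finite M2 M1 ..
  note [measurable] = D[THEN L2_measurable] u[THEN L2_measurable]
  have D': "(\<lambda>(y, x). D (x, y)) \<in> L2 (M2 \<Otimes>\<^sub>M M1)"
    using integrable_product_swap[OF L2_integrable_sq[OF D]]
    by (intro L2I) (simp_all add: case_prod_unfold)
  show "(\<lambda>y. l2_inner M1 (\<lambda>x. D (x, y)) u) \<in> L2 M2"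
    using Q.partial_l2_inner_snd(1)[OF D' u] by simp
  assume w: "w \<in> L2 M2"
  note [measurable] = w[THEN L2_measurable]
  have "l2_inner (M1 \<Otimes>\<^sub>M M2) D (tensor u w) = l2_inner (M2 \<Otimes>\<^sub>M M1) (\<lambda>(y, x). D (x, y)) (tensor w u)"
    unfolding l2_inner_def tensor_def
    by (subst integral_product_swap[symmetric]) (simp_all add: case_prod_unfold mult.commute)
  then show "l2_inner (M1 \<Otimes>\<^sub>M M2) D (tensor u w)
      = l2_inner M2 (\<lambda>y. l2_inner M1 (\<lambda>x. D (x, y)) u) w"
    using Q.partial_l2_inner_snd(2)[OF D' u w] by simp
qed

end

section \<open>Sums of tensor products\<close>

lemma low_rank_sum_eq: "low_rank_sum X S W = (\<lambda>p. \<Sum>i\<in>UNIV. \<Sum>j\<in>UNIV. S $ i $ j * tensor (X i) (W j) p)"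
  by (auto simp: low_rank_sum_def tensor_def fun_eq_iff mult_ac)

text \<open>The product-rule derivative of \<open>low_rank_sum\<close>. The directions are
  arbitrary, so that it describes the velocity of the given curve and every test vector
  alike.\<close>

definition low_rank_variation ::
  "('r::finite \<Rightarrow> 'a \<Rightarrow> complex) \<Rightarrow> ('r \<Rightarrow> 'a \<Rightarrow> complex) \<Rightarrow> complex^'r^'r \<Rightarrow> complex^'r^'r \<Rightarrow>
   ('r \<Rightarrow> 'b \<Rightarrow> complex) \<Rightarrow> ('r \<Rightarrow> 'b \<Rightarrow> complex) \<Rightarrow> 'a \<times> 'b \<Rightarrow> complex" where
  "low_rank_variation X dX S dS W dW = (\<lambda>p. \<Sum>i\<in>UNIV. \<Sum>j\<in>UNIV.
     dS $ i $ j * tensor (X i) (W j) p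
       + S $ i $ j * (tensor (dX i) (W j) p + tensor (X i) (dW j) p))"

lemma l2_orthonormalD:
  assumes "l2_orthonormal M X"
  shows "X i \<in> L2 M" and "l2_inner M (X i) (X j) = (if i = j then 1 else 0)"
  using assms by (auto simp: l2_orthonormal_def)

text \<open>An invertible matrix has trivial kernel. This removes \<open>S\<close> when only its
  combinations of unknown pairings are known to vanish.\<close>

lemma invertible_row_sums_eq_0:
  fixes S :: "complex^'r::finite^'r"
  assumes "invertible S" and "\<And>i. (\<Sum>j\<in>UNIV. S $ i $ j * v j) = 0"
  shows "v j = 0"
proof -
  have "S *v (\<chi> j. v j) = 0"
    using assms(2) by (simp add: matrix_vector_mult_def vec_eq_iff)
  then have "(\<chi> j. v j) = 0"
    using assms(1) matrix_left_invertible_ker[of S] by (auto simp: invertible_def)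
  then show ?thesis by (simp add: vec_eq_iff)
qed

text \<open>The row version applied to the transpose.\<close>

lemma invertible_column_sums_eq_0:
  fixes S :: "complex^'r::finite^'r"
  assumes "invertible S" and "\<And>j. (\<Sum>i\<in>UNIV. S $ i $ j * v i) = 0"
  shows "v i = 0"
proof (rule invertible_row_sums_eq_0)
  show "invertible (transpose S)"
    using assms(1) by (simp add: invertible_det_nz)
qed (simp add: transpose_def assms(2))

section \<open>Variations, change of factorisation, and residuals\<close>

context pair_sigma_finite
begin

lemma L2_variation:
  assumes "\<And>i. X i \<in> L2 M1" "\<And>i. dX i \<in> L2 M1" "\<And>j. W j \<in> L2 M2" "\<And>j. dW j \<in> L2 M2"
  shows "low_rank_variation X dX S dS W dW \<in> L2 (M1 \<Otimes>\<^sub>M M2)"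
  unfolding low_rank_variation_def by (intro L2_intros L2_tensor assms)

lemma l2_inner_variation_left:
  assumes "\<And>i. X i \<in> L2 M1" "\<And>i. dX i \<in> L2 M1" "\<And>j. W j \<in> L2 M2" "\<And>j. dW j \<in> L2 M2"
    and "u \<in> L2 M1" "w \<in> L2 M2"
  shows "l2_inner (M1 \<Otimes>\<^sub>M M2) (low_rank_variation X dX S dS W dW) (tensor u w)
    = (\<Sum>i\<in>UNIV. \<Sum>j\<in>UNIV. dS $ i $ j * (l2_inner M1 (X i) u * l2_inner M2 (W j) w)
       + S $ i $ j * (l2_inner M1 (dX i) u * l2_inner M2 (W j) w
         + l2_inner M1 (X i) u * l2_inner M2 (dW j) w))"
  unfolding low_rank_variation_def
  by (simp add: l2_inner_sum_left l2_inner_add_left l2_inner_cmul_left l2_inner_tensor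
      L2_intros L2_tensor assms)

lemma l2_inner_variation_right:
  assumes "\<And>i. X i \<in> L2 M1" "\<And>i. dX i \<in> L2 M1" "\<And>j. W j \<in> L2 M2" "\<And>j. dW j \<in> L2 M2"
    and "D \<in> L2 (M1 \<Otimes>\<^sub>M M2)"
  shows "l2_inner (M1 \<Otimes>\<^sub>M M2) D (low_rank_variation X dX S dS W dW)
    = (\<Sum>i\<in>UNIV. \<Sum>j\<in>UNIV. cnj (dS $ i $ j) * l2_inner (M1 \<Otimes>\<^sub>M M2) D (tensor (X i) (W j))
       + cnj (S $ i $ j) * (l2_inner (M1 \<Otimes>\<^sub>M M2) D (tensor (dX i) (W j))
         + l2_inner (M1 \<Otimes>\<^sub>M M2) D (tensor (X i) (dW j))))"
  unfolding low_rank_variation_def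
  by (simp add: l2_inner_sum_right l2_inner_add_right l2_inner_cmul_right L2_intros L2_tensor assms)

lemma l2_inner_tensor_sum:
  assumes "\<And>i. X i \<in> L2 M1" "\<And>j. W j \<in> L2 M2" "u \<in> L2 M1" "w \<in> L2 M2"
  shows "l2_inner (M1 \<Otimes>\<^sub>M M2) (\<lambda>p. \<Sum>i\<in>A. \<Sum>j\<in>B. S $ i $ j * tensor (X i) (W j) p) (tensor u w)
    = (\<Sum>i\<in>A. \<Sum>j\<in>B. S $ i $ j * (l2_inner M1 (X i) u * l2_inner M2 (W j) w))"
  by (simp add: l2_inner_sum_left l2_inner_cmul_left l2_inner_tensor L2_intros L2_tensor assms)

lemma has_l2_deriv_tensor_sum:
  fixes X :: "real \<Rightarrow> 'r::finite \<Rightarrow> 'a \<Rightarrow> complex"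
  assumes "\<And>i. has_l2_deriv M1 T (\<lambda>s. X s i) (dX i) t"
    and S: "(S has_vector_derivative dS) (at t within T)"
    and "\<And>j. has_l2_deriv M2 T (\<lambda>s. W s j) (dW j) t" and t: "t \<in> T"
  shows "has_l2_deriv (M1 \<Otimes>\<^sub>M M2) T
    (\<lambda>s p. \<Sum>i\<in>UNIV. \<Sum>j\<in>UNIV. S s $ i $ j * tensor (X s i) (W s j) p)
    (low_rank_variation (X t) dX (S t) dS (W t) dW) t"
proof -
  have "((\<lambda>s. S s $ i $ j) has_vector_derivative dS $ i $ j) (at t within T)" for i j
    by (intro bounded_linear.has_vector_derivative[OF bounded_linear_vec_nth] S)
  then show ?thesis
    unfolding low_rank_variation_def
    by (intro has_l2_deriv_sum has_l2_deriv_cmul has_l2_deriv_tensor assms)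
qed

text \<open>The span of the \<open>X i\<close> does not depend on the chosen factorisation; this is expressed through its
  orthogonal complement, and tested weakly against \<open>Y \<otimes> W' b\<close>.\<close>

lemma orthogonal_fst_factors:
  fixes X X' :: "'r::finite \<Rightarrow> 'a \<Rightarrow> complex" and S S' :: "complex^'r^'r"
  assumes X: "\<And>i. X i \<in> L2 M1" and W: "\<And>j. W j \<in> L2 M2" and X': "\<And>i. X' i \<in> L2 M1"
    and W': "l2_orthonormal M2 W'" and S': "invertible S'"
    and eq: "AE p in M1 \<Otimes>\<^sub>M M2. (\<Sum>i\<in>UNIV. \<Sum>j\<in>UNIV. S' $ i $ j * tensor (X' i) (W' j) p)
      = (\<Sum>i\<in>UNIV. \<Sum>j\<in>UNIV. S $ i $ j * tensor (X i) (W j) p)"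
    and Y: "Y \<in> L2 M1" "\<And>i. l2_inner M1 (X i) Y = 0"
  shows "l2_inner M1 (X' i) Y = 0"
proof (rule invertible_column_sums_eq_0[OF S'])
  fix b
  note o = l2_orthonormalD[OF W']
  \<comment> \<open>On the left, orthonormality of \<open>W'\<close> retains only column
    \<open>b\<close> of \<open>S'\<close>; on the right every term vanishes because \<open>Y\<close>
    is orthogonal to each \<open>X i\<close>.\<close>
  have "l2_inner (M1 \<Otimes>\<^sub>M M2) (\<lambda>p. \<Sum>i\<in>UNIV. \<Sum>j\<in>UNIV. S' $ i $ j * tensor (X' i) (W' j) p) (tensor Y (W' b))
    = l2_inner (M1 \<Otimes>\<^sub>M M2) (\<lambda>p. \<Sum>i\<in>UNIV. \<Sum>j\<in>UNIV. S $ i $ j * tensor (X i) (W j) p) (tensor Y (W' b))"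
    by (rule l2_inner_cong_AE[OF eq]) (auto intro!: L2_measurable L2_intros L2_tensor X W X' o Y)
  then show "(\<Sum>i\<in>UNIV. S' $ i $ b * l2_inner M1 (X' i) Y) = 0"
    by (simp add: l2_inner_tensor_sum X W X' o Y if_distrib cong: if_cong)
qed

text \<open>The mirror image: testing against \<open>tensor (X' a) Y\<close> isolates row
  \<open>a\<close> of \<open>S'\<close>.\<close>

lemma orthogonal_snd_factors:
  fixes W W' :: "'r::finite \<Rightarrow> 'b \<Rightarrow> complex" and S S' :: "complex^'r^'r"
  assumes X: "\<And>i. X i \<in> L2 M1" and W: "\<And>j. W j \<in> L2 M2" and W': "\<And>j. W' j \<in> L2 M2"
    and X': "l2_orthonormal M1 X'" and S': "invertible S'"
    and eq: "AE p in M1 \<Otimes>\<^sub>M M2. (\<Sum>i\<in>UNIV. \<Sum>j\<in>UNIV. S' $ i $ j * tensor (X' i) (W' j) p)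
      = (\<Sum>i\<in>UNIV. \<Sum>j\<in>UNIV. S $ i $ j * tensor (X i) (W j) p)"
    and Y: "Y \<in> L2 M2" "\<And>j. l2_inner M2 (W j) Y = 0"
  shows "l2_inner M2 (W' j) Y = 0"
proof (rule invertible_row_sums_eq_0[OF S'])
  fix a
  note o = l2_orthonormalD[OF X']
  have "l2_inner (M1 \<Otimes>\<^sub>M M2) (\<lambda>p. \<Sum>i\<in>UNIV. \<Sum>j\<in>UNIV. S' $ i $ j * tensor (X' i) (W' j) p) (tensor (X' a) Y)
    = l2_inner (M1 \<Otimes>\<^sub>M M2) (\<lambda>p. \<Sum>i\<in>UNIV. \<Sum>j\<in>UNIV. S $ i $ j * tensor (X i) (W j) p) (tensor (X' a) Y)"
    by (rule l2_inner_cong_AE[OF eq]) (auto intro!: L2_measurable L2_intros L2_tensor X W W' o Y)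
  moreover have "(\<Sum>i\<in>UNIV. \<Sum>j\<in>UNIV. S' $ i $ j * (l2_inner M1 (X' i) (X' a) * l2_inner M2 (W' j) Y))
    = (\<Sum>i\<in>UNIV. if i = a then \<Sum>j\<in>UNIV. S' $ i $ j * l2_inner M2 (W' j) Y else 0)"
    by (intro sum.cong refl) (simp add: o)
  ultimately show "(\<Sum>j\<in>UNIV. S' $ a $ j * l2_inner M2 (W' j) Y) = 0"
    by (simp add: l2_inner_tensor_sum X W W' o Y)
qed

text \<open>\<open>Q j\<close> is left side minus right side of the equation for the
  \<open>X\<close> factors. Against \<open>tensor u (W j)\<close> the gauge removes the
  \<open>dW\<close> terms, orthonormality of \<open>W\<close> leaves the terms with index
  \<open>j\<close>, and Fubini handles \<open>G\<close>.\<close>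

lemma residual_fst:
  fixes X :: "'r::finite \<Rightarrow> 'a \<Rightarrow> complex" and S dS :: "complex^'r^'r"
  assumes X: "\<And>i. X i \<in> L2 M1" "\<And>i. dX i \<in> L2 M1"
    and W: "l2_orthonormal M2 W" "\<And>j. dW j \<in> L2 M2"
    and gauge: "\<And>i j. l2_inner M2 (dW i) (W j) = 0"
    and G: "G \<in> L2 (M1 \<Otimes>\<^sub>M M2)"
  defines "Q \<equiv> \<lambda>j x. (\<Sum>k\<in>UNIV. S $ k $ j * dX k x) + (\<Sum>k\<in>UNIV. dS $ k $ j * X k x)
    - l2_inner M2 (\<lambda>y. G (x, y)) (W j)"
  shows "Q j \<in> L2 M1"
    and "u \<in> L2 M1 \<Longrightarrow> l2_inner (M1 \<Otimes>\<^sub>M M2)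
      (\<lambda>p. low_rank_variation X dX S dS W dW p - G p) (tensor u (W j)) = l2_inner M1 (Q j) u"
proof -
  note o = l2_orthonormalD[OF W(1)]
  show "Q j \<in> L2 M1"
    unfolding Q_def by (intro L2_intros X partial_l2_inner_snd G o)
  assume u: "u \<in> L2 M1"
  have "l2_inner M1 (Q j) u = (\<Sum>k\<in>UNIV. S $ k $ j * l2_inner M1 (dX k) u)
      + (\<Sum>k\<in>UNIV. dS $ k $ j * l2_inner M1 (X k) u)
      - l2_inner (M1 \<Otimes>\<^sub>M M2) G (tensor u (W j))"
    unfolding Q_def
    by (simp add: l2_inner_diff_left l2_inner_add_left l2_inner_sum_left l2_inner_cmul_left
        L2_intros X partial_l2_inner_snd G o u)
  moreover have "l2_inner (M1 \<Otimes>\<^sub>M M2) (low_rank_variation X dX S dS W dW) (tensor u (W j))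
    = (\<Sum>k\<in>UNIV. S $ k $ j * l2_inner M1 (dX k) u) + (\<Sum>k\<in>UNIV. dS $ k $ j * l2_inner M1 (X k) u)"
  proof -
    have "(\<Sum>b\<in>UNIV. dS $ a $ b * (l2_inner M1 (X a) u * l2_inner M2 (W b) (W j))
        + S $ a $ b * (l2_inner M1 (dX a) u * l2_inner M2 (W b) (W j)
          + l2_inner M1 (X a) u * l2_inner M2 (dW b) (W j)))
      = (\<Sum>b\<in>UNIV. if b = j then S $ a $ b * l2_inner M1 (dX a) u
          + dS $ a $ b * l2_inner M1 (X a) u else 0)" for a
      by (intro sum.cong refl) (simp add: o gauge)
    then show ?thesis
      by (simp add: l2_inner_variation_left X W o u sum.distrib)
  qed
  ultimately show "l2_inner (M1 \<Otimes>\<^sub>M M2)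
      (\<lambda>p. low_rank_variation X dX S dS W dW p - G p) (tensor u (W j)) = l2_inner M1 (Q j) u"
    by (simp add: l2_inner_diff_left L2_variation L2_tensor X W o G u)
qed

text \<open>The counterpart for the \<open>W\<close> factors; here the gauge on \<open>dX\<close>
  and the orthonormality of \<open>X\<close> do the work.\<close>

lemma residual_snd:
  fixes W :: "'r::finite \<Rightarrow> 'b \<Rightarrow> complex" and S dS :: "complex^'r^'r"
  assumes X: "l2_orthonormal M1 X" "\<And>i. dX i \<in> L2 M1"
    and W: "\<And>j. W j \<in> L2 M2" "\<And>j. dW j \<in> L2 M2"
    and gauge: "\<And>i j. l2_inner M1 (dX i) (X j) = 0"
    and G: "G \<in> L2 (M1 \<Otimes>\<^sub>M M2)"
  defines "R \<equiv> \<lambda>i y. (\<Sum>k\<in>UNIV. S $ i $ k * dW k y) + (\<Sum>k\<in>UNIV. dS $ i $ k * W k y)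
    - l2_inner M1 (\<lambda>x. G (x, y)) (X i)"
  shows "R i \<in> L2 M2"
    and "w \<in> L2 M2 \<Longrightarrow> l2_inner (M1 \<Otimes>\<^sub>M M2)
      (\<lambda>p. low_rank_variation X dX S dS W dW p - G p) (tensor (X i) w) = l2_inner M2 (R i) w"
proof -
  note o = l2_orthonormalD[OF X(1)]
  show "R i \<in> L2 M2"
    unfolding R_def by (intro L2_intros W partial_l2_inner_fst G o)
  assume w: "w \<in> L2 M2"
  have "l2_inner M2 (R i) w = (\<Sum>k\<in>UNIV. S $ i $ k * l2_inner M2 (dW k) w)
      + (\<Sum>k\<in>UNIV. dS $ i $ k * l2_inner M2 (W k) w)
      - l2_inner (M1 \<Otimes>\<^sub>M M2) G (tensor (X i) w)"
    unfolding R_def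
    by (simp add: l2_inner_diff_left l2_inner_add_left l2_inner_sum_left l2_inner_cmul_left
        L2_intros W partial_l2_inner_fst G o w)
  moreover have "l2_inner (M1 \<Otimes>\<^sub>M M2) (low_rank_variation X dX S dS W dW) (tensor (X i) w)
    = (\<Sum>a\<in>UNIV. if a = i then \<Sum>k\<in>UNIV. dS $ a $ k * l2_inner M2 (W k) w
        + S $ a $ k * l2_inner M2 (dW k) w else 0)"
    unfolding l2_inner_variation_left[OF o(1) X(2) W o(1) w]
    by (intro sum.cong refl) (simp add: o gauge)
  ultimately show "l2_inner (M1 \<Otimes>\<^sub>M M2)
      (\<lambda>p. low_rank_variation X dX S dS W dW p - G p) (tensor (X i) w) = l2_inner M2 (R i) w"
    by (simp add: l2_inner_diff_left L2_variation L2_tensor X W o G w sum.distrib)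
qed

end

lemma AE_0_if_orthogonal_to_unit_complement:
  assumes Q: "Q \<in> L2 M" and QX: "\<And>i. l2_inner M Q (X i) = 0"
    and unit: "\<And>u. u \<in> L2 M \<Longrightarrow> l2_sq M u = 1 \<Longrightarrow> (\<And>i. l2_inner M u (X i) = 0) \<Longrightarrow> l2_inner M Q u = 0"
  shows "AE z in M. Q z = 0"
proof (rule ccontr)
  assume "\<not> ?thesis"
  then have pos: "0 < l2_sq M Q"
    using Q l2_sq_nonneg[of M Q] by (simp add: l2_sq_eq_0_iff[symmetric])
  define c where "c = complex_of_real (1 / sqrt (l2_sq M Q))"
  have "l2_inner M Q (\<lambda>z. c * Q z) = 0"
  proof (rule unit)
    show "l2_sq M (\<lambda>z. c * Q z) = 1"
      unfolding l2_sq_cmul using pos by (simp add: c_def norm_divide power_divide)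
  qed (use Q QX in \<open>simp_all add: L2_cmul l2_inner_cmul_left\<close>)
  then have "cnj c * complex_of_real (l2_sq M Q) = 0"
    by (simp only: l2_inner_cmul_right l2_inner_self)
  moreover have "c \<noteq> 0"
    using pos by (simp add: c_def)
  ultimately show False
    using pos by simp
qed

section \<open>Smooth curves of factors\<close>

lemma smooth_curve_const: "smooth_curve T (\<lambda>t. c)"
  unfolding smooth_curve_def
  by (intro exI[of _ "\<lambda>k t. if k = 0 then c else 0"]) (auto intro!: derivative_eq_intros)

text \<open>Each differentiation advances the phase by a quarter turn, which gives one formula for
  all orders.\<close>

lemma smooth_curve_cos: "smooth_curve T (\<lambda>t. complex_of_real (cos t))"
  unfolding smooth_curve_def
proof (intro exI[of _ "\<lambda>k t. complex_of_real (cos (t + real k * (pi / 2)))"] conjI allI ballI)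
  show "((\<lambda>t. complex_of_real (cos (t + real k * (pi / 2)))) has_vector_derivative
      complex_of_real (cos (t + real (Suc k) * (pi / 2)))) (at t within T)" for k t
  proof (rule has_vector_derivative_of_real)
    have "cos (t + real (Suc k) * (pi / 2)) = - sin (t + real k * (pi / 2))"
      using cos_add[of "t + real k * (pi / 2)" "pi / 2"] by (simp add: algebra_simps add_divide_distrib)
    then show "((\<lambda>t. cos (t + real k * (pi / 2))) has_field_derivative
      cos (t + real (Suc k) * (pi / 2))) (at t within T)"
      by (auto intro!: derivative_eq_intros)
  qed
qed simp

lemma smooth_curve_sin: "smooth_curve T (\<lambda>t. complex_of_real (sin t))"
  unfolding smooth_curve_def
proof (intro exI[of _ "\<lambda>k t. complex_of_real (sin (t + real k * (pi / 2)))"] conjI allI ballI)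
  show "((\<lambda>t. complex_of_real (sin (t + real k * (pi / 2)))) has_vector_derivative
      complex_of_real (sin (t + real (Suc k) * (pi / 2)))) (at t within T)" for k t
  proof (rule has_vector_derivative_of_real)
    have "sin (t + real (Suc k) * (pi / 2)) = cos (t + real k * (pi / 2))"
      using sin_add[of "t + real k * (pi / 2)" "pi / 2"] by (simp add: algebra_simps add_divide_distrib)
    then show "((\<lambda>t. sin (t + real k * (pi / 2))) has_field_derivative
      sin (t + real (Suc k) * (pi / 2))) (at t within T)"
      by (auto intro!: derivative_eq_intros)
  qed
qed simp

lemma smooth_curve_affine: "smooth_curve T (\<lambda>t. a + t *\<^sub>R b)"
  unfolding smooth_curve_def
proof (intro exI[of _ "\<lambda>k t. if k = 0 then a + t *\<^sub>R b else if k = 1 then b else 0"] conjI allI ballI)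
  show "((\<lambda>t. if k = 0 then a + t *\<^sub>R b else if k = 1 then b else 0) has_vector_derivative
    (if Suc k = 0 then a + t *\<^sub>R b else if Suc k = 1 then b else 0)) (at t within T)" for k t
    by (cases "k = 0") (auto intro!: derivative_eq_intros)
qed simp

section \<open>Smooth curves in \<open>L2\<close> and rotations of orthonormal families\<close>

lemma l2_smooth_cmul_const:
  assumes "smooth_curve T a" and f: "f \<in> L2 M"
  shows "l2_smooth M T (\<lambda>t z. a t * f z)"
proof -
  from assms obtain D where D: "D 0 = a"
    "\<And>k t. t \<in> T \<Longrightarrow> (D k has_vector_derivative D (Suc k) t) (at t within T)"
    by (auto simp: smooth_curve_def)
  have "has_l2_deriv M T (\<lambda>t z. D k t * f z) (\<lambda>z. D (Suc k) t * f z) t" if "t \<in> T" for k t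
    using has_l2_deriv_cmul[OF D(2)[OF that] has_l2_deriv_const[OF f] that] by simp
  then show ?thesis
    unfolding l2_smooth_def by (intro exI[of _ "\<lambda>k t z. D k t * f z"]) (simp add: D)
qed

lemma l2_smooth_add:
  assumes "l2_smooth M T f" and "l2_smooth M T g"
  shows "l2_smooth M T (\<lambda>t z. f t z + g t z)"
proof -
  from assms(1) obtain D where D: "D 0 = f" "\<forall>k. \<forall>t\<in>T. has_l2_deriv M T (D k) (D (Suc k) t) t"
    unfolding l2_smooth_def by blast
  from assms(2) obtain E where E: "E 0 = g" "\<forall>k. \<forall>t\<in>T. has_l2_deriv M T (E k) (E (Suc k) t) t"
    unfolding l2_smooth_def by blast
  have "has_l2_deriv M T (\<lambda>t z. D k t z + E k t z) (\<lambda>z. D (Suc k) t z + E (Suc k) t z) t"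
    if "t \<in> T" for k t
    using D(2) E(2) that by (intro has_l2_deriv_add) blast+
  then show ?thesis
    unfolding l2_smooth_def by (intro exI[of _ "\<lambda>k t z. D k t z + E k t z"]) (simp add: D(1) E(1))
qed

lemma l2_smooth_const: "f \<in> L2 M \<Longrightarrow> l2_smooth M T (\<lambda>t. f)"
  using l2_smooth_cmul_const[OF smooth_curve_const[of T 1]] by simp

text \<open>Rotation by the angle \<open>\<tau>\<close> in the plane of \<open>X k\<close> and
  \<open>u\<close>. A straight line from \<open>X k\<close> towards \<open>u\<close> would leave the
  unit sphere. The case distinction sits in the coefficients so that all members have one
  shape.\<close>

definition rotate_family ::
  "'r \<Rightarrow> ('z \<Rightarrow> complex) \<Rightarrow> ('r \<Rightarrow> 'z \<Rightarrow> complex) \<Rightarrow> real \<Rightarrow> 'r \<Rightarrow> 'z \<Rightarrow> complex" where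
  "rotate_family k u X \<tau> i = (\<lambda>z. of_real (if i = k then cos \<tau> else 1) * X i z
     + of_real (if i = k then sin \<tau> else 0) * u z)"

lemma rotate_family_0: "rotate_family k u X 0 = X"
  by (simp add: rotate_family_def fun_eq_iff)

lemma l2_smooth_rotate_family:
  assumes "\<And>i. X i \<in> L2 M" and "u \<in> L2 M"
  shows "l2_smooth M T (\<lambda>\<tau>. rotate_family k u X \<tau> i)"
  unfolding rotate_family_def using assms
  by (cases "i = k")
    (auto intro!: l2_smooth_add l2_smooth_cmul_const smooth_curve_cos smooth_curve_sin l2_smooth_const)

lemma has_l2_deriv_rotate_family:
  assumes "\<And>i. X i \<in> L2 M" and "u \<in> L2 M" and "0 \<in> T"
  shows "has_l2_deriv M T (\<lambda>\<tau>. rotate_family k u X \<tau> i) (if i = k then u else (\<lambda>z. 0)) 0"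
proof (cases "i = k")
  case True
  have "((\<lambda>\<tau>. complex_of_real (cos \<tau>)) has_vector_derivative of_real 0) (at 0 within T)"
    "((\<lambda>\<tau>. complex_of_real (sin \<tau>)) has_vector_derivative of_real 1) (at 0 within T)"
    by (rule has_vector_derivative_of_real; auto intro!: derivative_eq_intros)+
  from has_l2_deriv_add[OF has_l2_deriv_cmul[OF this(1) has_l2_deriv_const] has_l2_deriv_cmul[OF this(2) has_l2_deriv_const],
      of "X k" M u] assms True
  show ?thesis by (simp add: rotate_family_def)
next
  case False
  then show ?thesis using has_l2_deriv_const[of "X i"] assms by (simp add: rotate_family_def)
qed

lemma l2_orthonormal_rotate_family:
  assumes X: "l2_orthonormal M X" and u: "u \<in> L2 M" "l2_sq M u = 1" "\<And>i. l2_inner M u (X i) = 0"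
  shows "l2_orthonormal M (rotate_family k u X \<tau>)"
proof -
  note o = l2_orthonormalD[OF X]
  have u': "l2_inner M (X i) u = 0" for i
    using u(3)[of i] cnj_l2_inner[of M u "X i"] by simp
  have "complex_of_real (cos \<tau>) * complex_of_real (cos \<tau>)
      + complex_of_real (sin \<tau>) * complex_of_real (sin \<tau>) = 1"
    by (simp only: of_real_mult[symmetric] of_real_add[symmetric] sin_cos_squared_add3) simp
  \<comment> \<open>With free coefficients one computation serves all pairs of members. The product
    \<open>b * cnj b'\<close> survives only when both indices equal \<open>k\<close>, where the
    squares of sine and cosine add up to 1.\<close>
  moreover have "l2_inner M (\<lambda>z. a * X i z + b * u z) (\<lambda>z. a' * X j z + b' * u z)
      = a * cnj a' * (if i = j then 1 else 0) + b * cnj b'" for i j a b a' b'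
    by (simp add: l2_inner_add_left l2_inner_add_right l2_inner_cmul_left l2_inner_cmul_right
        L2_add L2_cmul o u u' l2_inner_self)
  moreover have "(\<lambda>z. a * X i z + b * u z) \<in> L2 M" for i a b
    by (intro L2_add L2_cmul o u)
  ultimately show ?thesis
    unfolding l2_orthonormal_def rotate_family_def by simp
qed

text \<open>Only the first derivatives are extracted from the towers in the smoothness definitions;
  choice collects them into families over the index.\<close>

lemma smooth_low_rank_curveD:
  assumes "smooth_low_rank_curve \<pi> T X S W" and "t \<in> T"
  obtains dX dS dW where
    "\<forall>i. has_l2_deriv lborel T (\<lambda>s. X s i) (dX i) t"
    "(S has_vector_derivative dS) (at t within T)"
    "\<forall>j. has_l2_deriv (xi_measure \<pi>) T (\<lambda>s. W s j) (dW j) t"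
proof -
  have l2: "\<exists>f'. has_l2_deriv M T f f' t" if "l2_smooth M T f" for M :: "'z measure" and f
  proof -
    from that obtain D where "D 0 = f" "has_l2_deriv M T (D 0) (D (Suc 0) t) t"
      using assms(2) unfolding l2_smooth_def by blast
    then show ?thesis by auto
  qed
  have "\<forall>i. \<exists>f'. has_l2_deriv lborel T (\<lambda>s. X s i) f' t"
    using assms(1) by (intro allI l2) (simp add: smooth_low_rank_curve_def)
  then have "\<exists>dX. \<forall>i. has_l2_deriv lborel T (\<lambda>s. X s i) (dX i) t"
    by (rule choice)
  moreover have "\<forall>j. \<exists>f'. has_l2_deriv (xi_measure \<pi>) T (\<lambda>s. W s j) f' t"
    using assms(1) by (intro allI l2) (simp add: smooth_low_rank_curve_def)
  then have "\<exists>dW. \<forall>j. has_l2_deriv (xi_measure \<pi>) T (\<lambda>s. W s j) (dW j) t"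
    by (rule choice)
  moreover have "\<exists>dS. (S has_vector_derivative dS) (at t within T)"
  proof -
    from assms(1) obtain D where "D 0 = S" "(D 0 has_vector_derivative D (Suc 0) t) (at t within T)"
      using assms(2) unfolding smooth_low_rank_curve_def smooth_curve_def by blast
    then show ?thesis by auto
  qed
  ultimately show ?thesis using that by blast
qed

text \<open>The determinant is continuous in \<open>\<tau>\<close> and nonzero at 0. This keeps a
  linear motion of \<open>S\<close> on the manifold for a short time.\<close>

lemma invertible_affine_near_0:
  fixes S E :: "complex^'r::finite^'r"
  assumes "invertible S"
  obtains \<delta> :: real where "\<delta> > 0" and "\<And>\<tau>. \<tau> \<in> {-\<delta><..<\<delta>} \<Longrightarrow> invertible (S + \<tau> *\<^sub>R E)"
proof -
  have "isCont (\<lambda>\<tau>::real. det (S + \<tau> *\<^sub>R E)) 0"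
    unfolding det_def by (intro continuous_intros)
  moreover have "det (S + 0 *\<^sub>R E) \<noteq> 0"
    using assms by (simp add: invertible_det_nz)
  ultimately have "\<exists>\<delta>>0. \<forall>\<tau>. dist 0 \<tau> < \<delta> \<longrightarrow> det (S + \<tau> *\<^sub>R E) \<noteq> 0"
    using continuous_at_avoid by blast
  then show ?thesis
    using that by (auto simp: invertible_det_nz dist_real_def abs_less_iff)
qed

section \<open>Tangent vectors and the Galerkin condition\<close>

text \<open>An integrable density gives a finite measure, which makes the Fubini results above
  available.\<close>

lemma pair_sigma_finite_xi:
  assumes "has_bochner_integral lborel \<pi> c"
  shows "pair_sigma_finite (lborel :: (real^'m) measure) (xi_measure \<pi>)"
proof -
  have int: "integrable lborel \<pi>"
    using assms by (rule integrable.intros)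
  then have [measurable]: "\<pi> \<in> borel_measurable borel" by simp
  have "emeasure (xi_measure \<pi>) (space (xi_measure \<pi>)) = (\<integral>\<^sup>+\<xi>. ennreal (\<pi> \<xi>) \<partial>lborel)"
    by (simp add: xi_measure_def emeasure_density)
  also have "\<dots> \<le> (\<integral>\<^sup>+\<xi>. ennreal (norm (\<pi> \<xi>)) \<partial>lborel)"
    by (intro nn_integral_mono ennreal_leI) simp
  also have "\<dots> < \<infinity>"
    using int by (simp add: integrable_iff_bounded)
  finally have "finite_measure (xi_measure \<pi>)"
    by (intro finite_measureI) simp
  then show ?thesis
    by (rule pair_sigma_finite.intro[OF sigma_finite_lborel finite_measure.axioms(1)])
qed

lemma has_l2_deriv_low_rank_sum:
  fixes X :: "real \<Rightarrow> 'r::finite \<Rightarrow> real^'m \<Rightarrow> complex" and \<pi> :: "real^'n \<Rightarrow> real"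
  assumes "pair_sigma_finite (lborel :: (real^'m) measure) (xi_measure \<pi>)"
    and "\<And>i. has_l2_deriv lborel T (\<lambda>s. X s i) (dX i) t"
    and "(S has_vector_derivative dS) (at t within T)"
    and "\<And>j. has_l2_deriv (xi_measure \<pi>) T (\<lambda>s. W s j) (dW j) t" and "t \<in> T"
  shows "has_l2_deriv (xxi_measure \<pi>) T (\<lambda>s. low_rank_sum (X s) (S s) (W s))
    (low_rank_variation (X t) dX (S t) dS (W t) dW) t"
  unfolding low_rank_sum_eq xxi_measure_def
  by (rule pair_sigma_finite.has_l2_deriv_tensor_sum) (fact assms)+

lemma low_rank_tangentI:
  fixes X :: "real \<Rightarrow> 'r::finite \<Rightarrow> real^'m \<Rightarrow> complex" and \<pi> :: "real^'n \<Rightarrow> real"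
  assumes "pair_sigma_finite (lborel :: (real^'m) measure) (xi_measure \<pi>)"
    and "\<delta> > 0" and "smooth_low_rank_curve \<pi> {-\<delta><..<\<delta>} X S W"
    and "\<And>i. has_l2_deriv lborel {-\<delta><..<\<delta>} (\<lambda>s. X s i) (dX i) 0"
    and "(S has_vector_derivative dS) (at 0 within {-\<delta><..<\<delta>})"
    and "\<And>j. has_l2_deriv (xi_measure \<pi>) {-\<delta><..<\<delta>} (\<lambda>s. W s j) (dW j) 0"
  shows "low_rank_variation (X 0) dX (S 0) dS (W 0) dW
    \<in> low_rank_tangent_space TYPE('r) \<pi> (low_rank_sum (X 0) (S 0) (W 0))"
proof -
  have "has_l2_deriv (xxi_measure \<pi>) {-\<delta><..<\<delta>} (\<lambda>\<tau>. low_rank_sum (X \<tau>) (S \<tau>) (W \<tau>))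
    (low_rank_variation (X 0) dX (S 0) dS (W 0) dW) 0"
    by (rule has_l2_deriv_low_rank_sum) (fact assms | use assms(2) in simp)+
  then show ?thesis
    unfolding low_rank_tangent_space_def using assms(2,3) by blast
qed

text \<open>The given derivative and the product rule differentiate the same curve, so they agree
  almost everywhere by uniqueness. The factors obtained may differ from those in which
  \<open>\<psi>\<close> was written.\<close>

lemma low_rank_tangentE:
  fixes \<pi> :: "real^'n \<Rightarrow> real" and \<psi> :: "(real^'m) \<times> (real^'n) \<Rightarrow> complex"
  assumes p: "pair_sigma_finite (lborel :: (real^'m) measure) (xi_measure \<pi>)"
    and \<eta>: "\<eta> \<in> low_rank_tangent_space TYPE('r::finite) \<pi> \<psi>"
  obtains X dX :: "'r::finite \<Rightarrow> real^'m \<Rightarrow> complex" and S dS and W dW :: "'r \<Rightarrow> real^'n \<Rightarrow> complex"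
  where "low_rank_factors \<pi> X S W" "\<forall>i. dX i \<in> L2 lborel" "\<forall>j. dW j \<in> L2 (xi_measure \<pi>)"
    and "AE p in xxi_measure \<pi>. low_rank_sum X S W p = \<psi> p"
    and "\<eta> \<in> L2 (xxi_measure \<pi>)"
    and "AE p in xxi_measure \<pi>. \<eta> p = low_rank_variation X dX S dS W dW p"
proof -
  from \<eta> obtain \<delta> and X :: "real \<Rightarrow> 'r \<Rightarrow> real^'m \<Rightarrow> complex" and S W where \<delta>: "\<delta> > 0"
    and c: "smooth_low_rank_curve \<pi> {-\<delta><..<\<delta>} X S W"
    and eq: "AE p in xxi_measure \<pi>. low_rank_sum (X 0) (S 0) (W 0) p = \<psi> p"
    and d: "has_l2_deriv (xxi_measure \<pi>) {-\<delta><..<\<delta>} (\<lambda>\<tau>. low_rank_sum (X \<tau>) (S \<tau>) (W \<tau>)) \<eta> 0"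
    unfolding low_rank_tangent_space_def by blast
  have 0: "0 \<in> {-\<delta><..<\<delta>}" using \<delta> by simp
  obtain dX dS dW where e: "\<forall>i. has_l2_deriv lborel {-\<delta><..<\<delta>} (\<lambda>s. X s i) (dX i) 0"
    "(S has_vector_derivative dS) (at 0 within {-\<delta><..<\<delta>})"
    "\<forall>j. has_l2_deriv (xi_measure \<pi>) {-\<delta><..<\<delta>} (\<lambda>s. W s j) (dW j) 0"
    by (rule smooth_low_rank_curveD[OF c 0])
  note e = e[rule_format]
  have v: "has_l2_deriv (xxi_measure \<pi>) {-\<delta><..<\<delta>} (\<lambda>\<tau>. low_rank_sum (X \<tau>) (S \<tau>) (W \<tau>))
    (low_rank_variation (X 0) dX (S 0) dS (W 0) dW) 0"
    by (rule has_l2_deriv_low_rank_sum) (fact p e 0)+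
  have nt: "at 0 within {-\<delta><..<\<delta>} \<noteq> bot"
    using at_within_open[OF 0 open_greaterThanLessThan] by simp
  show ?thesis
  proof (rule that[of "X 0" "S 0" "W 0" dX dW dS])
    show "low_rank_factors \<pi> (X 0) (S 0) (W 0)"
      using c 0 by (auto simp: smooth_low_rank_curve_def)
    show "AE p in xxi_measure \<pi>. \<eta> p = low_rank_variation (X 0) dX (S 0) dS (W 0) dW p"
      by (rule has_l2_deriv_unique[OF d v 0 nt])
  qed (use eq has_l2_derivD(2)[OF d] has_l2_derivD(2)[OF e(1)] has_l2_derivD(2)[OF e(3)] in simp_all)
qed

text \<open>The invertible matrix \<open>S\<close> mixes the tangent directions in which a single \<open>X k\<close> or \<open>W k\<close> moves, so
  testing against all of them isolates each \<open>tensor u (W j)\<close> and \<open>tensor (X i) w\<close>.\<close>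

lemma galerkin_imp_orthogonal:
  fixes X :: "'r::finite \<Rightarrow> real^'m \<Rightarrow> complex" and W :: "'r \<Rightarrow> real^'n \<Rightarrow> complex"
  assumes p: "pair_sigma_finite (lborel :: (real^'m) measure) (xi_measure \<pi>)"
    and lr: "low_rank_factors \<pi> X S W" and D: "D \<in> L2 (xxi_measure \<pi>)"
    and gal: "\<forall>\<eta> \<in> low_rank_tangent_space TYPE('r) \<pi> (low_rank_sum X S W).
      l2_inner (xxi_measure \<pi>) D \<eta> = 0"
  shows "l2_inner (xxi_measure \<pi>) D (tensor (X i) (W j)) = 0"
    and "u \<in> L2 lborel \<Longrightarrow> l2_sq lborel u = 1 \<Longrightarrow> (\<And>i. l2_inner lborel u (X i) = 0) \<Longrightarrow>
      l2_inner (xxi_measure \<pi>) D (tensor u (W j)) = 0"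
    and "w \<in> L2 (xi_measure \<pi>) \<Longrightarrow> l2_sq (xi_measure \<pi>) w = 1 \<Longrightarrow>
      (\<And>j. l2_inner (xi_measure \<pi>) w (W j) = 0) \<Longrightarrow>
      l2_inner (xxi_measure \<pi>) D (tensor (X i) w) = 0"
proof -
  interpret pair_sigma_finite "lborel :: (real^'m) measure" "xi_measure \<pi>" by (rule p)
  have X: "l2_orthonormal lborel X" and W: "l2_orthonormal (xi_measure \<pi>) W" and S: "invertible S"
    using lr by (auto simp: low_rank_factors_def)
  note oX = l2_orthonormalD[OF X] and oW = l2_orthonormalD[OF W]
  note right = l2_inner_variation_right[OF _ _ _ _ D[unfolded xxi_measure_def], folded xxi_measure_def]
  have zero: "tensor (\<lambda>x. 0) w = (\<lambda>p. 0)" "tensor u (\<lambda>y. 0) = (\<lambda>p. 0)"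
    for u :: "real^'m \<Rightarrow> complex" and w :: "real^'n \<Rightarrow> complex"
    by (auto simp: tensor_def fun_eq_iff)
  show "l2_inner (xxi_measure \<pi>) D (tensor (X i) (W j)) = 0"
  proof -
    \<comment> \<open>The matrix unit at \<open>(i, j)\<close>: moving \<open>S\<close> along it
      produces the tangent vector \<open>tensor (X i) (W j)\<close>. The nested conditionals let the
      two sums collapse one after the other.\<close>
    define E :: "complex^'r^'r" where "E = (\<chi> a b. if a = i then if b = j then 1 else 0 else 0)"
    obtain \<delta> :: real where \<delta>: "\<delta> > 0" "\<And>\<tau>. \<tau> \<in> {-\<delta><..<\<delta>} \<Longrightarrow> invertible (S + \<tau> *\<^sub>R E)"
      using invertible_affine_near_0[OF S, of E] by blast
    have "low_rank_variation X (\<lambda>i x. 0) (S + 0 *\<^sub>R E) E W (\<lambda>j y. 0)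
      \<in> low_rank_tangent_space TYPE('r) \<pi> (low_rank_sum X (S + 0 *\<^sub>R E) W)"
    proof (rule low_rank_tangentI[OF p \<delta>(1),
        where X = "\<lambda>\<tau>. X" and S = "\<lambda>\<tau>. S + \<tau> *\<^sub>R E" and W = "\<lambda>\<tau>. W"])
      show "smooth_low_rank_curve \<pi> {-\<delta><..<\<delta>} (\<lambda>\<tau>. X) (\<lambda>\<tau>. S + \<tau> *\<^sub>R E) (\<lambda>\<tau>. W)"
        using X W \<delta>(2) by (auto simp: smooth_low_rank_curve_def low_rank_factors_def
            intro!: l2_smooth_const smooth_curve_affine oX oW)
      show "((\<lambda>\<tau>. S + \<tau> *\<^sub>R E) has_vector_derivative E) (at 0 within {-\<delta><..<\<delta>})"
        by (auto intro!: derivative_eq_intros)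
    qed (auto intro!: has_l2_deriv_const oX oW)
    then have "l2_inner (xxi_measure \<pi>) D (low_rank_variation X (\<lambda>i x. 0) S E W (\<lambda>j y. 0)) = 0"
      using gal by simp
    moreover have "(\<Sum>b\<in>UNIV. cnj (E $ a $ b) * l2_inner (xxi_measure \<pi>) D (tensor (X a) (W b)))
      = (if a = i then l2_inner (xxi_measure \<pi>) D (tensor (X i) (W j)) else 0)" for a
    proof -
      have "(\<Sum>b\<in>UNIV. cnj (E $ a $ b) * l2_inner (xxi_measure \<pi>) D (tensor (X a) (W b)))
        = (\<Sum>b\<in>UNIV. if b = j then if a = i then l2_inner (xxi_measure \<pi>) D (tensor (X a) (W b)) else 0 else 0)"
        by (intro sum.cong refl) (simp add: E_def)
      then show ?thesis by simp
    qed
    ultimately show ?thesis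
      by (simp add: right oX oW L2_zero zero l2_inner_zero_right)
  qed
  show "l2_inner (xxi_measure \<pi>) D (tensor u (W j)) = 0"
    if u: "u \<in> L2 lborel" "l2_sq lborel u = 1" "\<And>i. l2_inner lborel u (X i) = 0"
  proof -
    \<comment> \<open>Rotating \<open>X k\<close> towards \<open>u\<close> tests against row
      \<open>k\<close> of \<open>S\<close>. The second slot conjugates the coefficients, so the
      pairings are conjugated here in order that \<open>S\<close> itself acts on them.\<close>
    have "(\<Sum>b\<in>UNIV. S $ k $ b * cnj (l2_inner (xxi_measure \<pi>) D (tensor u (W b)))) = 0" for k
    proof -
      let ?dX = "\<lambda>i. if i = k then u else (\<lambda>x. 0)"
      have "low_rank_variation (rotate_family k u X 0) ?dX S 0 W (\<lambda>j y. 0)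
        \<in> low_rank_tangent_space TYPE('r) \<pi> (low_rank_sum (rotate_family k u X 0) S W)"
      proof (rule low_rank_tangentI[OF p zero_less_one,
          where X = "rotate_family k u X" and S = "\<lambda>\<tau>. S" and W = "\<lambda>\<tau>. W"])
        show "smooth_low_rank_curve \<pi> {- 1<..<1} (rotate_family k u X) (\<lambda>\<tau>. S) (\<lambda>\<tau>. W)"
          using X W S u by (auto simp: smooth_low_rank_curve_def low_rank_factors_def
            intro!: l2_smooth_const smooth_curve_const l2_smooth_rotate_family
              l2_orthonormal_rotate_family oX oW)
        show "has_l2_deriv lborel {- 1<..<1} (\<lambda>s. rotate_family k u X s i) (?dX i) 0" for i
          by (rule has_l2_deriv_rotate_family) (auto intro: oX u)
      qed (auto intro!: has_l2_deriv_const oW)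
      then have "l2_inner (xxi_measure \<pi>) D (low_rank_variation X ?dX S 0 W (\<lambda>j y. 0)) = 0"
        using gal by (simp add: rotate_family_0)
      moreover have "l2_inner (xxi_measure \<pi>) D (low_rank_variation X ?dX S 0 W (\<lambda>j y. 0))
        = (\<Sum>a\<in>UNIV. if a = k then
            \<Sum>b\<in>UNIV. cnj (S $ a $ b) * l2_inner (xxi_measure \<pi>) D (tensor u (W b)) else 0)"
      proof -
        have "?dX a \<in> L2 lborel" for a by (simp add: u L2_zero)
        note right[where X = X and dX = ?dX and W = W and dW = "\<lambda>j y. 0", OF oX(1) this oW(1) L2_zero]
        then show ?thesis
          by (simp only:) (intro sum.cong refl, simp add: zero l2_inner_zero_right)
      qed
      ultimately have "(\<Sum>b\<in>UNIV. cnj (S $ k $ b) * l2_inner (xxi_measure \<pi>) D (tensor u (W b))) = 0"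
        by simp
      from arg_cong[OF this, of cnj] show ?thesis by simp
    qed
    from invertible_row_sums_eq_0[OF S this] show ?thesis by simp
  qed
  show "l2_inner (xxi_measure \<pi>) D (tensor (X i) w) = 0"
    if w: "w \<in> L2 (xi_measure \<pi>)" "l2_sq (xi_measure \<pi>) w = 1" "\<And>j. l2_inner (xi_measure \<pi>) w (W j) = 0"
  proof -
    \<comment> \<open>Likewise, rotating \<open>W k\<close> towards \<open>w\<close> tests against
      column \<open>k\<close> of \<open>S\<close>.\<close>
    have "(\<Sum>a\<in>UNIV. S $ a $ k * cnj (l2_inner (xxi_measure \<pi>) D (tensor (X a) w))) = 0" for k
    proof -
      let ?dW = "\<lambda>j. if j = k then w else (\<lambda>y. 0)"
      have "low_rank_variation X (\<lambda>i x. 0) S 0 (rotate_family k w W 0) ?dW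
        \<in> low_rank_tangent_space TYPE('r) \<pi> (low_rank_sum X S (rotate_family k w W 0))"
      proof (rule low_rank_tangentI[OF p zero_less_one,
          where X = "\<lambda>\<tau>. X" and S = "\<lambda>\<tau>. S" and W = "rotate_family k w W"])
        show "smooth_low_rank_curve \<pi> {- 1<..<1} (\<lambda>\<tau>. X) (\<lambda>\<tau>. S) (rotate_family k w W)"
          using X W S w by (auto simp: smooth_low_rank_curve_def low_rank_factors_def
            intro!: l2_smooth_const smooth_curve_const l2_smooth_rotate_family
              l2_orthonormal_rotate_family oX oW)
        show "has_l2_deriv (xi_measure \<pi>) {- 1<..<1} (\<lambda>s. rotate_family k w W s j) (?dW j) 0" for j
          by (rule has_l2_deriv_rotate_family) (auto intro: oW w)
      qed (auto intro!: has_l2_deriv_const oX)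
      then have "l2_inner (xxi_measure \<pi>) D (low_rank_variation X (\<lambda>i x. 0) S 0 W ?dW) = 0"
        using gal by (simp add: rotate_family_0)
      moreover have "l2_inner (xxi_measure \<pi>) D (low_rank_variation X (\<lambda>i x. 0) S 0 W ?dW)
        = (\<Sum>a\<in>UNIV. \<Sum>b\<in>UNIV.
            if b = k then cnj (S $ a $ b) * l2_inner (xxi_measure \<pi>) D (tensor (X a) w) else 0)"
      proof -
        have "?dW b \<in> L2 (xi_measure \<pi>)" for b by (simp add: w L2_zero)
        note right[where X = X and dX = "\<lambda>i x. 0" and W = W and dW = ?dW, OF oX(1) L2_zero oW(1) this]
        then show ?thesis
          by (simp only:) (intro sum.cong refl, simp add: zero l2_inner_zero_right)
      qed
      ultimately have "(\<Sum>a\<in>UNIV. cnj (S $ a $ k) * l2_inner (xxi_measure \<pi>) D (tensor (X a) w)) = 0"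
        by simp
      from arg_cong[OF this, of cnj] show ?thesis by simp
    qed
    from invertible_column_sums_eq_0[OF S this] show ?thesis by simp
  qed
qed

text \<open>A tangent vector is a variation of some factors \<open>X'\<close>, \<open>W'\<close>.
  Every term in it contains one of these, so it suffices to carry the orthogonality of
  \<open>D\<close> over from \<open>X\<close>, \<open>W\<close> to \<open>X'\<close>,
  \<open>W'\<close>.\<close>

lemma orthogonal_imp_galerkin:
  fixes X :: "'r::finite \<Rightarrow> real^'m \<Rightarrow> complex" and W :: "'r \<Rightarrow> real^'n \<Rightarrow> complex"
  assumes p: "pair_sigma_finite (lborel :: (real^'m) measure) (xi_measure \<pi>)"
    and lr: "low_rank_factors \<pi> X S W" and D: "D \<in> L2 (xxi_measure \<pi>)"
    and u: "\<And>u j. u \<in> L2 lborel \<Longrightarrow> l2_inner (xxi_measure \<pi>) D (tensor u (W j)) = 0"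
    and w: "\<And>w i. w \<in> L2 (xi_measure \<pi>) \<Longrightarrow> l2_inner (xxi_measure \<pi>) D (tensor (X i) w) = 0"
    and \<eta>: "\<eta> \<in> low_rank_tangent_space TYPE('r) \<pi> (low_rank_sum X S W)"
  shows "l2_inner (xxi_measure \<pi>) D \<eta> = 0"
proof -
  interpret pair_sigma_finite "lborel :: (real^'m) measure" "xi_measure \<pi>" by (rule p)
  have X: "l2_orthonormal lborel X" and W: "l2_orthonormal (xi_measure \<pi>) W"
    using lr by (auto simp: low_rank_factors_def)
  note oX = l2_orthonormalD[OF X] and oW = l2_orthonormalD[OF W]
  obtain X' dX' :: "'r \<Rightarrow> real^'m \<Rightarrow> complex" and S' dS' and W' dW' :: "'r \<Rightarrow> real^'n \<Rightarrow> complex"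
    where lr': "low_rank_factors \<pi> X' S' W'"
      and d: "\<forall>i. dX' i \<in> L2 lborel" "\<forall>j. dW' j \<in> L2 (xi_measure \<pi>)"
      and eq: "AE p in xxi_measure \<pi>. low_rank_sum X' S' W' p = low_rank_sum X S W p"
      and \<eta>2: "\<eta> \<in> L2 (xxi_measure \<pi>)"
      and \<eta>_eq: "AE p in xxi_measure \<pi>. \<eta> p = low_rank_variation X' dX' S' dS' W' dW' p"
    by (rule low_rank_tangentE[OF p \<eta>])
  note d = d[rule_format]
  have X': "l2_orthonormal lborel X'" and W': "l2_orthonormal (xi_measure \<pi>) W'" and S': "invertible S'"
    using lr' by (auto simp: low_rank_factors_def)
  note oX' = l2_orthonormalD[OF X'] and oW' = l2_orthonormalD[OF W']
  note D' = D[unfolded xxi_measure_def]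
  note eq' = eq[unfolded low_rank_sum_eq xxi_measure_def]
  have fst0: "l2_inner (xxi_measure \<pi>) D (tensor (X' i) w) = 0" if w2: "w \<in> L2 (xi_measure \<pi>)" for i w
  proof -
    \<comment> \<open>This function represents the pairing of \<open>D\<close> with tensors whose
      second factor is \<open>w\<close>. Being orthogonal to every \<open>X a\<close>, it is
      orthogonal to every \<open>X' i\<close> as well.\<close>
    let ?Y = "\<lambda>x. l2_inner (xi_measure \<pi>) (\<lambda>y. D (x, y)) w"
    have "l2_inner lborel (X' i) ?Y = 0"
    proof (rule orthogonal_fst_factors[where X = X and X' = X' and W = W, OF oX(1) oW(1) oX'(1) W' S' eq'])
      show "?Y \<in> L2 lborel"
        by (rule partial_l2_inner_snd(1)[OF D' w2])
      have "l2_inner lborel ?Y (X a) = 0" for a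
        using w[OF w2, of a] partial_l2_inner_snd(2)[OF D' w2 oX(1)] by (simp add: xxi_measure_def)
      then show "l2_inner lborel (X a) ?Y = 0" for a
        by (subst cnj_l2_inner[symmetric]) simp
    qed
    then have "l2_inner lborel ?Y (X' i) = 0"
      by (subst cnj_l2_inner[symmetric]) simp
    then show ?thesis
      using partial_l2_inner_snd(2)[OF D' w2 oX'(1)] by (simp add: xxi_measure_def)
  qed
  have snd0: "l2_inner (xxi_measure \<pi>) D (tensor u (W' j)) = 0" if u2: "u \<in> L2 lborel" for j u
  proof -
    let ?Y = "\<lambda>y. l2_inner lborel (\<lambda>x. D (x, y)) u"
    have "l2_inner (xi_measure \<pi>) (W' j) ?Y = 0"
    proof (rule orthogonal_snd_factors[where X = X and W' = W' and W = W, OF oX(1) oW(1) oW'(1) X' S' eq'])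
      show "?Y \<in> L2 (xi_measure \<pi>)"
        by (rule partial_l2_inner_fst(1)[OF D' u2])
      have "l2_inner (xi_measure \<pi>) ?Y (W b) = 0" for b
        using u[OF u2, of b] partial_l2_inner_fst(2)[OF D' u2 oW(1)] by (simp add: xxi_measure_def)
      then show "l2_inner (xi_measure \<pi>) (W b) ?Y = 0" for b
        by (subst cnj_l2_inner[symmetric]) simp
    qed
    then have "l2_inner (xi_measure \<pi>) ?Y (W' j) = 0"
      by (subst cnj_l2_inner[symmetric]) simp
    then show ?thesis
      using partial_l2_inner_fst(2)[OF D' u2 oW'(1)] by (simp add: xxi_measure_def)
  qed
  have v: "low_rank_variation X' dX' S' dS' W' dW' \<in> L2 (xxi_measure \<pi>)"
    unfolding xxi_measure_def by (intro L2_variation oX' oW' d)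
  have "l2_inner (xxi_measure \<pi>) D \<eta>
    = l2_inner (xxi_measure \<pi>) D (low_rank_variation X' dX' S' dS' W' dW')"
    by (rule l2_inner_cong_AE[OF _ \<eta>_eq]) (auto intro: L2_measurable D \<eta>2 v)
  \<comment> \<open>The terms with \<open>dX'\<close> are covered by \<open>snd0\<close>, those with
    \<open>dW'\<close> and those with \<open>dS'\<close> by \<open>fst0\<close>.\<close>
  also have "\<dots> = 0"
    using l2_inner_variation_right[where X = X' and dX = dX' and W = W' and dW = dW',
        OF oX'(1) d(1) oW'(1) d(2) D', of S' dS']
    by (simp add: fst0 snd0 oX' oW' d flip: xxi_measure_def)
  finally show ?thesis .
qed

text \<open>The equivalence at a frozen time: \<open>G\<close> stands for the right-hand side of the
  evolution equation, and the derivatives of the factors are merely \<open>L2\<close> functions in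
  the gauge.\<close>

lemma galerkin_iff_factor_equations:
  fixes X :: "'r::finite \<Rightarrow> real^'m \<Rightarrow> complex" and W :: "'r \<Rightarrow> real^'n \<Rightarrow> complex"
  assumes p: "pair_sigma_finite (lborel :: (real^'m) measure) (xi_measure \<pi>)"
    and lr: "low_rank_factors \<pi> X S W"
    and d: "\<And>i. dX i \<in> L2 lborel" "\<And>j. dW j \<in> L2 (xi_measure \<pi>)"
    and gauge_X: "\<And>i j. l2_inner lborel (dX i) (X j) = 0"
    and gauge_W: "\<And>i j. l2_inner (xi_measure \<pi>) (dW i) (W j) = 0"
    and G: "G \<in> L2 (xxi_measure \<pi>)"
  shows "(\<forall>\<eta> \<in> low_rank_tangent_space TYPE('r) \<pi> (low_rank_sum X S W).
      l2_inner (xxi_measure \<pi>) (\<lambda>p. low_rank_variation X dX S dS W dW p - G p) \<eta> = 0)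
    \<longleftrightarrow>
    (\<forall>i j. dS $ i $ j = l2_inner (xxi_measure \<pi>) G (tensor (X i) (W j))) \<and>
    (\<forall>i. AE \<xi> in xi_measure \<pi>. (\<Sum>k\<in>UNIV. S $ i $ k * dW k \<xi>)
      = partial_inner_x G (X i) \<xi> - (\<Sum>k\<in>UNIV. dS $ i $ k * W k \<xi>)) \<and>
    (\<forall>j. AE x in lborel. (\<Sum>k\<in>UNIV. dX k x * S $ k $ j)
      = partial_inner_xi \<pi> G (W j) x - (\<Sum>k\<in>UNIV. X k x * dS $ k $ j))"
    (is "?gal \<longleftrightarrow> ?S \<and> ?W \<and> ?X")
proof -
  interpret pair_sigma_finite "lborel :: (real^'m) measure" "xi_measure \<pi>" by (rule p)
  have X: "l2_orthonormal lborel X" and W: "l2_orthonormal (xi_measure \<pi>) W"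
    using lr by (auto simp: low_rank_factors_def)
  note oX = l2_orthonormalD[OF X] and oW = l2_orthonormalD[OF W]
  note G' = G[unfolded xxi_measure_def]
  define D where "D = (\<lambda>p. low_rank_variation X dX S dS W dW p - G p)"
  define Q where "Q = (\<lambda>j x. (\<Sum>k\<in>UNIV. S $ k $ j * dX k x) + (\<Sum>k\<in>UNIV. dS $ k $ j * X k x)
    - l2_inner (xi_measure \<pi>) (\<lambda>y. G (x, y)) (W j))"
  define R where "R = (\<lambda>i y. (\<Sum>k\<in>UNIV. S $ i $ k * dW k y) + (\<Sum>k\<in>UNIV. dS $ i $ k * W k y)
    - l2_inner lborel (\<lambda>x. G (x, y)) (X i))"
  have D: "D \<in> L2 (xxi_measure \<pi>)"
    unfolding D_def xxi_measure_def by (intro L2_diff L2_variation oX oW d G')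
  have Q2: "Q j \<in> L2 lborel" for j
    unfolding Q_def by (rule residual_fst(1)[where X = X and dX = dX and W = W and dW = dW, OF oX(1) d(1) W d(2) gauge_W G'])
  have DQ: "l2_inner (xxi_measure \<pi>) D (tensor u (W j)) = l2_inner lborel (Q j) u"
    if "u \<in> L2 lborel" for u j
    unfolding D_def Q_def xxi_measure_def
    by (rule residual_fst(2)[where X = X and dX = dX and W = W and dW = dW, OF oX(1) d(1) W d(2) gauge_W G' that])
  have R2: "R i \<in> L2 (xi_measure \<pi>)" for i
    unfolding R_def by (rule residual_snd(1)[where X = X and dX = dX and W = W and dW = dW, OF X d(1) oW(1) d(2) gauge_X G'])
  have DR: "l2_inner (xxi_measure \<pi>) D (tensor (X i) w) = l2_inner (xi_measure \<pi>) (R i) w"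
    if "w \<in> L2 (xi_measure \<pi>)" for w i
    unfolding D_def R_def xxi_measure_def
    by (rule residual_snd(2)[where X = X and dX = dX and W = W and dW = dW, OF X d(1) oW(1) d(2) gauge_X G' that])
  have W_iff: "?W \<longleftrightarrow> (\<forall>i. AE \<xi> in xi_measure \<pi>. R i \<xi> = 0)"
    by (simp add: R_def partial_inner_x_def algebra_simps)
  have X_iff: "?X \<longleftrightarrow> (\<forall>j. AE x in lborel. Q j x = 0)"
    by (simp add: Q_def partial_inner_xi_def algebra_simps)
  \<comment> \<open>Both gauge conditions remove the moving-factor terms, and orthonormality leaves
    a single entry of \<open>dS\<close>.\<close>
  have DS: "l2_inner (xxi_measure \<pi>) D (tensor (X i) (W j))
    = dS $ i $ j - l2_inner (xxi_measure \<pi>) G (tensor (X i) (W j))" for i j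
  proof -
    have "l2_inner (xxi_measure \<pi>) (low_rank_variation X dX S dS W dW) (tensor (X i) (W j))
      = (\<Sum>a\<in>UNIV. \<Sum>b\<in>UNIV. if b = j then if a = i then dS $ i $ j else 0 else 0)"
      unfolding xxi_measure_def l2_inner_variation_left[where X = X and dX = dX and W = W and dW = dW,
          OF oX(1) d(1) oW(1) d(2) oX(1) oW(1)]
      by (intro sum.cong refl) (simp add: oX oW gauge_X gauge_W)
    then have "l2_inner (xxi_measure \<pi>) (low_rank_variation X dX S dS W dW) (tensor (X i) (W j)) = dS $ i $ j"
      by simp
    then show ?thesis
      unfolding D_def xxi_measure_def
      by (subst l2_inner_diff_left) (auto intro!: L2_variation L2_tensor oX oW d G')
  qed
  show ?thesis
    unfolding W_iff X_iff
  proof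
    assume gal: ?gal
    note orth = galerkin_imp_orthogonal[OF p lr D gal[folded D_def]]
    have "dS $ i $ j = l2_inner (xxi_measure \<pi>) G (tensor (X i) (W j))" for i j
      using orth(1)[of i j] DS by simp
    moreover have "AE \<xi> in xi_measure \<pi>. R i \<xi> = 0" for i
    \<comment> \<open>Linear motion of \<open>S\<close> gives orthogonality of the residual to each
      \<open>W j\<close>; rotations of the \<open>W\<close> family give it on the unit vectors of
      the complement.\<close>
    proof (rule AE_0_if_orthogonal_to_unit_complement[OF R2, where X = W])
      show "l2_inner (xi_measure \<pi>) (R i) (W j) = 0" for j
        using orth(1)[of i j] DR[OF oW(1)] by simp
      show "l2_inner (xi_measure \<pi>) (R i) w = 0" if "w \<in> L2 (xi_measure \<pi>)"
        "l2_sq (xi_measure \<pi>) w = 1" "\<And>j. l2_inner (xi_measure \<pi>) w (W j) = 0" for w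
        using orth(3)[OF that, of i] DR[OF that(1)] by simp
    qed
    moreover have "AE x in lborel. Q j x = 0" for j
    proof (rule AE_0_if_orthogonal_to_unit_complement[OF Q2, where X = X])
      show "l2_inner lborel (Q j) (X i) = 0" for i
        using orth(1)[of i j] DQ[OF oX(1)] by simp
      show "l2_inner lborel (Q j) u = 0" if "u \<in> L2 lborel"
        "l2_sq lborel u = 1" "\<And>i. l2_inner lborel u (X i) = 0" for u
        using orth(2)[OF that, of j] DQ[OF that(1)] by simp
    qed
    ultimately show "?S \<and> (\<forall>i. AE \<xi> in xi_measure \<pi>. R i \<xi> = 0) \<and> (\<forall>j. AE x in lborel. Q j x = 0)"
      by blast
  next
    assume eqs: "?S \<and> (\<forall>i. AE \<xi> in xi_measure \<pi>. R i \<xi> = 0) \<and> (\<forall>j. AE x in lborel. Q j x = 0)"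
    have zero: "l2_inner M f g = 0" if "AE z in M. f z = 0" "f \<in> L2 M" "g \<in> L2 M"
      for M :: "'z measure" and f g
    proof -
      have "l2_inner M f g = l2_inner M (\<lambda>z. 0) g"
        using that by (intro l2_inner_cong_AE) (simp_all add: L2_measurable)
      then show ?thesis by (simp add: l2_inner_zero_left)
    qed
    show ?gal
      unfolding D_def[symmetric]
    proof
      fix \<eta> assume \<eta>: "\<eta> \<in> low_rank_tangent_space TYPE('r) \<pi> (low_rank_sum X S W)"
      show "l2_inner (xxi_measure \<pi>) D \<eta> = 0"
      proof (rule orthogonal_imp_galerkin[OF p lr D _ _ \<eta>])
        show "l2_inner (xxi_measure \<pi>) D (tensor u (W j)) = 0" if "u \<in> L2 lborel" for u j
          unfolding DQ[OF that] using eqs by (intro zero Q2 that) simp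
        show "l2_inner (xxi_measure \<pi>) D (tensor (X i) w) = 0" if "w \<in> L2 (xi_measure \<pi>)" for w i
          unfolding DR[OF that] using eqs by (intro zero R2 that) simp
      qed
    qed
  qed
qed

text \<open>At each time the claim reduces to \<open>galerkin_iff_factor_equations\<close>, once the
  chosen representatives are known to be derivatives and \<open>d\<psi> t\<close> is known to agree
  almost everywhere with the product-rule variation.\<close>

theorem theorem2p1:
  fixes \<pi> :: "real^'n \<Rightarrow> real"
    and V :: "real^'m \<Rightarrow> real^'n \<Rightarrow> real"
    and \<epsilon> :: real
    and T :: "real set"
    and X :: "real \<Rightarrow> 'r::finite \<Rightarrow> real^'m \<Rightarrow> complex"
    and S :: "real \<Rightarrow> complex^'r^'r"
    and W :: "real \<Rightarrow> 'r \<Rightarrow> real^'n \<Rightarrow> complex"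
    and \<psi> :: "real \<Rightarrow> (real^'m) \<times> (real^'n) \<Rightarrow> complex"
    and F :: "((real^'m) \<times> (real^'n) \<Rightarrow> complex) \<Rightarrow> (real^'m) \<times> (real^'n) \<Rightarrow> complex"
    and dX :: "real \<Rightarrow> 'r \<Rightarrow> real^'m \<Rightarrow> complex"
    and dS :: "real \<Rightarrow> complex^'r^'r"
    and dW :: "real \<Rightarrow> 'r \<Rightarrow> real^'n \<Rightarrow> complex"
    and d\<psi> :: "real \<Rightarrow> (real^'m) \<times> (real^'n) \<Rightarrow> complex"
  assumes psi_eq: "\<psi> = (\<lambda>t. low_rank_sum (X t) (S t) (W t))"
    and F_eq: "F = schroedinger_rhs \<epsilon> V"
    and dX_eq: "dX = (\<lambda>t i. l2_deriv lborel T (\<lambda>s. X s i) t)"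
    and dS_eq: "dS = (\<lambda>t. vector_derivative S (at t within T))"
    and dW_eq: "dW = (\<lambda>t j. l2_deriv (xi_measure \<pi>) T (\<lambda>s. W s j) t)"
    and dpsi_eq: "d\<psi> = (\<lambda>t. l2_deriv (xxi_measure \<pi>) T \<psi> t)"
    and density: "\<And>\<xi>. 0 \<le> \<pi> \<xi>" "has_bochner_integral lborel \<pi> 1"
    and eps: "\<epsilon> > 0"
    and interval: "is_interval T" "interior T \<noteq> {}"
    and curve: "smooth_low_rank_curve \<pi> T X S W"
    and regular: "\<And>t i. t \<in> T \<Longrightarrow> has_laplacian (X t i)"
    and F_L2: "\<And>t. t \<in> T \<Longrightarrow> F (\<psi> t) \<in> L2 (xxi_measure \<pi>)"
    and gauge_X: "\<And>t i j. t \<in> T \<Longrightarrow> l2_inner lborel (dX t i) (X t j) = 0"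
    and gauge_W: "\<And>t i j. t \<in> T \<Longrightarrow> l2_inner (xi_measure \<pi>) (dW t i) (W t j) = 0"
  shows "\<forall>t\<in>T.
    (\<forall>\<eta> \<in> low_rank_tangent_space TYPE('r) \<pi> (\<psi> t).
        l2_inner (xxi_measure \<pi>) (\<lambda>p. d\<psi> t p - F (\<psi> t) p) \<eta> = 0)
    \<longleftrightarrow>
    (\<forall>i j. dS t $ i $ j
        = l2_inner (xxi_measure \<pi>) (F (\<psi> t)) (\<lambda>(x, \<xi>). X t i x * W t j \<xi>)) \<and>
    (\<forall>i. AE \<xi> in xi_measure \<pi>.
        (\<Sum>k\<in>UNIV. S t $ i $ k * dW t k \<xi>)
          = partial_inner_x (F (\<psi> t)) (X t i) \<xi> - (\<Sum>k\<in>UNIV. dS t $ i $ k * W t k \<xi>)) \<and>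
    (\<forall>j. AE x in lborel.
        (\<Sum>k\<in>UNIV. dX t k x * S t $ k $ j)
          = partial_inner_xi \<pi> (F (\<psi> t)) (W t j) x - (\<Sum>k\<in>UNIV. X t k x * dS t $ k $ j))"
proof
  fix t assume t: "t \<in> T"
  have p: "pair_sigma_finite (lborel :: (real^'m) measure) (xi_measure \<pi>)"
    by (rule pair_sigma_finite_xi[OF density(2)])
  \<comment> \<open>Every point of a nondegenerate interval is a limit point of it, end points
    included. This makes the derivatives at \<open>t\<close> unique.\<close>
  have nt: "at t within T \<noteq> bot"
  proof -
    from interval(2) obtain c e where ce: "e > 0" "ball c e \<subseteq> T"
      by (auto simp: mem_interior)
    have "connected T" using interval(1) by (simp add: is_interval_connected_1)
    moreover have "T \<noteq> {a}" for a
    proof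
      assume "T = {a}"
      \<comment> \<open>Two distinct points of the ball would both be the single point of
        \<open>T\<close>.\<close>
      then have "c = a" "c + e / 2 = a"
        using ce subsetD[OF ce(2), of c] subsetD[OF ce(2), of "c + e / 2"] by (auto simp: dist_real_def)
      then show False using ce(1) by simp
    qed
    ultimately have "t islimpt T"
      using t by (intro connected_imp_perfect)
    then show ?thesis by (simp add: trivial_limit_within)
  qed
  obtain dX' dS' dW' where d': "\<forall>i. has_l2_deriv lborel T (\<lambda>s. X s i) (dX' i) t"
    "(S has_vector_derivative dS') (at t within T)"
    "\<forall>j. has_l2_deriv (xi_measure \<pi>) T (\<lambda>s. W s j) (dW' j) t"
    by (rule smooth_low_rank_curveD[OF curve t])
  note d' = d'[rule_format]
  have lr: "low_rank_factors \<pi> (X t) (S t) (W t)"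
    using curve t by (simp add: smooth_low_rank_curve_def)
  have dX: "has_l2_deriv lborel T (\<lambda>s. X s i) (dX t i) t" for i
    unfolding dX_eq by (rule has_l2_deriv_l2_deriv[OF d'(1)])
  have dW: "has_l2_deriv (xi_measure \<pi>) T (\<lambda>s. W s j) (dW t j) t" for j
    unfolding dW_eq by (rule has_l2_deriv_l2_deriv[OF d'(3)])
  have dS: "(S has_vector_derivative dS t) (at t within T)"
    using d'(2) vector_derivative_within[OF nt d'(2)] by (simp add: dS_eq)
  let ?v = "low_rank_variation (X t) (dX t) (S t) (dS t) (W t) (dW t)"
  have v: "has_l2_deriv (xxi_measure \<pi>) T \<psi> ?v t"
    unfolding psi_eq by (rule has_l2_deriv_low_rank_sum) (fact p dX dS dW t)+
  have d\<psi>: "has_l2_deriv (xxi_measure \<pi>) T \<psi> (d\<psi> t) t"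
    unfolding dpsi_eq by (rule has_l2_deriv_l2_deriv[OF v])
  \<comment> \<open>\<open>d\<psi> t\<close> is an arbitrarily chosen representative, equal to
    \<open>?v\<close> only almost everywhere; that suffices inside the inner product.\<close>
  have "l2_inner (xxi_measure \<pi>) (\<lambda>p. d\<psi> t p - F (\<psi> t) p) \<eta>
    = l2_inner (xxi_measure \<pi>) (\<lambda>p. ?v p - F (\<psi> t) p) \<eta>"
    if "\<eta> \<in> low_rank_tangent_space TYPE('r) \<pi> (\<psi> t)" for \<eta>
  proof (rule l2_inner_cong_AE)
    show "AE p in xxi_measure \<pi>. d\<psi> t p - F (\<psi> t) p = ?v p - F (\<psi> t) p"
      using has_l2_deriv_unique[OF d\<psi> v t nt] by simp
    show "\<eta> \<in> borel_measurable (xxi_measure \<pi>)" "\<eta> \<in> borel_measurable (xxi_measure \<pi>)"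
      using that unfolding low_rank_tangent_space_def by (auto dest: has_l2_derivD(2) intro: L2_measurable)
  qed (use F_L2[OF t] has_l2_derivD(2)[OF v] has_l2_derivD(2)[OF d\<psi>] in \<open>auto intro!: L2_measurable L2_diff\<close>)
  then have "(\<forall>\<eta> \<in> low_rank_tangent_space TYPE('r) \<pi> (\<psi> t).
        l2_inner (xxi_measure \<pi>) (\<lambda>p. d\<psi> t p - F (\<psi> t) p) \<eta> = 0)
    \<longleftrightarrow> (\<forall>\<eta> \<in> low_rank_tangent_space TYPE('r) \<pi> (low_rank_sum (X t) (S t) (W t)).
        l2_inner (xxi_measure \<pi>) (\<lambda>p. ?v p - F (\<psi> t) p) \<eta> = 0)"
    by (simp add: psi_eq)
  also note galerkin_iff_factor_equations[where X = "X t" and dX = "dX t" and W = "W t" and dW = "dW t",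
      OF p lr has_l2_derivD(2)[OF dX] has_l2_derivD(2)[OF dW]
      gauge_X[OF t] gauge_W[OF t] F_L2[OF t], of "dS t", unfolded tensor_def]
  finally show "(\<forall>\<eta> \<in> low_rank_tangent_space TYPE('r) \<pi> (\<psi> t).
        l2_inner (xxi_measure \<pi>) (\<lambda>p. d\<psi> t p - F (\<psi> t) p) \<eta> = 0)
    \<longleftrightarrow>
    (\<forall>i j. dS t $ i $ j
        = l2_inner (xxi_measure \<pi>) (F (\<psi> t)) (\<lambda>(x, \<xi>). X t i x * W t j \<xi>)) \<and>
    (\<forall>i. AE \<xi> in xi_measure \<pi>.
        (\<Sum>k\<in>UNIV. S t $ i $ k * dW t k \<xi>)
          = partial_inner_x (F (\<psi> t)) (X t i) \<xi> - (\<Sum>k\<in>UNIV. dS t $ i $ k * W t k \<xi>)) \<and>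
    (\<forall>j. AE x in lborel.
        (\<Sum>k\<in>UNIV. dX t k x * S t $ k $ j)
          = partial_inner_xi \<pi> (F (\<psi> t)) (W t j) x - (\<Sum>k\<in>UNIV. X t k x * dS t $ k $ j))" .
qed

end
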